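(* Let $X\neq\{0\}$ be a complex Banach space with open unit ball $\mathbb{B}$, let $k\geq 1$ be an integer, let $f:\mathbb{B}\to\mathbb{C}$ be holomorphic, and suppose that the mapping $F(z)=z f(z)$ belongs to $\mathcal{S}^*(\mathbb{B})$. For $z\in\mathbb{B}\setminus\{0\}$ and $l_z\in T_z$ put $$ a_{2k+1}=\frac{l_z\big(D^{2k+1}F(0)(z^{2k+1})\big)}{(2k+1)!\,\|z\|^{2k+1}},\qquad a_{k+1}=\frac{l_z\big(D^{k+1}F(0)(z^{k+1})\big)}{(k+1)!\,\|z\|^{k+1}}. $$ If $F(z)-z$ has a zero of order $k+1$ at $z=0$, then for every $z\in\mathbb{B}\setminus\{0\}$ and every $l_z\in T_z$, $$ \left\vert 1 - a_{2k+1}^2 - 2a_{k+1}^2 + 2a_{k+1}^2 a_{2k+1} \right\vert \leq \begin{cases} 1+\dfrac{8}{k^2}+\dfrac{(k+2)(6-k)}{k^4}, & 1\leq k\leq 3,\\[2mm] 1+\dfrac{8}{k^2}+\dfrac{2+k}{k^3}, & k\geq 3. \end{cases} $$ The bound is sharp for $k=1,2,3$: for every such $X$ and each $k\in\{1,2,3\}$ there are a mapping $F$ satisfying the hypotheses, a point $z\in\mathbb{B}\setminus\{0\}$ and $l_z\in T_z$ for which equality holds.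
   Context: For $z\in X\setminus\{0\}$, $T_z=\{l_z: X\to\mathbb{C} \text{ continuous linear}: l_z(z)=\|z\|,\ \|l_z\|=1\}$ (non-empty by Hahn–Banach). For a holomorphic mapping $F$ on a neighbourhood of $0$ in $X$ and an integer $m\ge1$, $D^mF(0)$ is the $m$-th Fréchet derivative at $0$, a bounded symmetric $m$-linear mapping, and $D^mF(0)(z^m)=D^mF(0)(z,\dots,z)$ ($m$ times). A holomorphic mapping $F:\mathbb{B}\to X$ is normalized if $F(0)=0$ and $DF(0)=I$ (identity operator on $X$), and locally biholomorphic if $DF(z)$ has a bounded inverse for each $z\in\mathbb{B}$. The class $\mathcal{S}^*(\mathbb{B})$ of starlike mappings on $\mathbb{B}$ consists of all normalized locally biholomorphic mappings $F:\mathbb{B}\to X$ such that $\operatorname{Re}\big(l_z([DF(z)]^{-1}F(z))\big)>0$ for all $z\in\mathbb{B}\setminus\{0\}$ and all $l_z\in T_z$. A holomorphic mapping $g$ from a domain of $X$ containing $0$ into $X$ has a zero of order $m$ at $z=0$ ($m\in\mathbb{N}$) if $g(0)=0$, $Dg(0)=0,\dots,D^{m-1}g(0)=0$ and $D^{m}g(0)\neq 0$. *)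

theory Defs
  imports "HOL-Analysis.Analysis"
begin

class complex_banach = banach +
  fixes scaleC :: "complex \<Rightarrow> 'a \<Rightarrow> 'a"  (infixr "*\<^sub>C" 75)
  assumes scaleC_add_right: "c *\<^sub>C (x + y) = c *\<^sub>C x + c *\<^sub>C y"
    and scaleC_add_left: "(c + d) *\<^sub>C x = c *\<^sub>C x + d *\<^sub>C x"
    and scaleC_scaleC: "c *\<^sub>C d *\<^sub>C x = (c * d) *\<^sub>C x"
    and scaleC_of_real: "complex_of_real r *\<^sub>C x = r *\<^sub>R x"
    and norm_scaleC: "norm (c *\<^sub>C x) = cmod c * norm x"

instantiation complex :: complex_banach
begin

definition scaleC_complex :: "complex \<Rightarrow> complex \<Rightarrow> complex"
  where "scaleC_complex c x = c * x"

instance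
  by standard (auto simp: scaleC_complex_def algebra_simps norm_mult scaleR_conv_of_real)

end

definition bounded_clinear :: "('a::complex_banach \<Rightarrow> 'b::complex_banach) \<Rightarrow> bool"
  where "bounded_clinear L \<longleftrightarrow> bounded_linear L \<and> (\<forall>c x. L (c *\<^sub>C x) = c *\<^sub>C L x)"

text \<open>
  Holomorphy is complex Frechet differentiability at every point. The sets used are open,
  and real Frechet derivatives are unique, so \<^const>\<open>frechet_derivative\<close> of a holomorphic map
  is its complex Frechet derivative.
\<close>

definition holomorphic_map_on :: "('a::complex_banach \<Rightarrow> 'b::complex_banach) \<Rightarrow> 'a set \<Rightarrow> bool"
  where "holomorphic_map_on F S \<longleftrightarrow>
    (\<forall>z\<in>S. \<exists>L. bounded_clinear L \<and> (F has_derivative L) (at z))"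

text \<open>
  The \<open>m\<close>-th Frechet derivative at \<open>x\<close>, evaluated at \<open>(v 0, \<dots>, v (m - 1))\<close>. The space of
  \<open>m\<close>-linear maps cannot be a type depending on \<open>m\<close>, so the derivative of
  \<open>y \<mapsto> D\<^sup>m f(y)\<close> is taken after evaluation at a fixed tuple, which is a bounded linear
  operation on that space. The lemma below shows that this is the derivative with respect to
  the operator norm on \<open>m\<close>-linear maps whenever the latter exists.
\<close>

primrec nth_frechet_derivative ::
    "nat \<Rightarrow> ('a::real_normed_vector \<Rightarrow> 'b::real_normed_vector) \<Rightarrow> 'a \<Rightarrow> (nat \<Rightarrow> 'a) \<Rightarrow> 'b"
  where
    "nth_frechet_derivative 0 f x v = f x"
  | "nth_frechet_derivative (Suc m) f x v =
       frechet_derivative (\<lambda>y. nth_frechet_derivative m f y v) (at x) (v m)"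

lemma nth_frechet_derivative_eq_operator_norm_derivative:
  fixes f :: "'a::real_normed_vector \<Rightarrow> 'b::real_normed_vector"
    and A :: "nat \<Rightarrow> 'a \<Rightarrow> (nat \<Rightarrow> 'a) \<Rightarrow> 'b"
  assumes "open S"
    and zero: "\<And>x v. x \<in> S \<Longrightarrow> A 0 x v = f x"
    and bounded: "\<And>j x v. j < m \<Longrightarrow> x \<in> S \<Longrightarrow> bounded_linear (\<lambda>h. A (Suc j) x (v(j := h)))"
    and deriv: "\<And>j x e. j < m \<Longrightarrow> x \<in> S \<Longrightarrow> 0 < e \<Longrightarrow>
      \<exists>d>0. \<forall>y. norm (y - x) < d \<longrightarrow>
        (\<forall>v. norm (A j y v - A j x v - A (Suc j) x (v(j := y - x)))
             \<le> e * norm (y - x) * (\<Prod>i<j. norm (v i)))"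
    and "x \<in> S"
  shows "nth_frechet_derivative m f x v = A m x v"
proof -
  have "n \<le> m \<Longrightarrow> \<forall>x\<in>S. \<forall>v. nth_frechet_derivative n f x v = A n x v" for n
  proof (induction n)
    case 0
    then show ?case using zero by simp
  next
    case (Suc j)
    then have j: "j < m" and IH: "\<And>x v. x \<in> S \<Longrightarrow> nth_frechet_derivative j f x v = A j x v"
      by auto
    have "nth_frechet_derivative (Suc j) f x v = A (Suc j) x v" if x: "x \<in> S" for x v
    proof -
      let ?L = "\<lambda>h. A (Suc j) x (v(j := h))"
      define p where "p = (\<Prod>i<j. norm (v i))"
      have p: "0 \<le> p" unfolding p_def by (simp add: prod_nonneg)
      have "((\<lambda>y. A j y v) has_derivative ?L) (at x)"
        unfolding has_derivative_at_alt
      proof (intro conjI allI impI)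
        show "bounded_linear ?L" using bounded[OF j x] .
        fix e :: real assume e: "0 < e"
        then have "0 < e / (p + 1)" using p by simp
        from deriv[OF j x this] obtain d where d: "d > 0" and
          *: "\<And>y v. norm (y - x) < d \<Longrightarrow> norm (A j y v - A j x v - A (Suc j) x (v(j := y - x)))
             \<le> e / (p + 1) * norm (y - x) * (\<Prod>i<j. norm (v i))" by blast
        have "norm (A j y v - A j x v - ?L (y - x)) \<le> e * norm (y - x)" if "norm (y - x) < d" for y
        proof -
          have "norm (A j y v - A j x v - ?L (y - x)) \<le> e / (p + 1) * norm (y - x) * p"
            using *[OF that, of v] by (simp add: p_def)
          also have "\<dots> = e * norm (y - x) * (p / (p + 1))" by simp
          also have "\<dots> \<le> e * norm (y - x) * 1"
            using p e by (intro mult_left_mono) (auto simp: divide_simps)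
          finally show ?thesis by simp
        qed
        with d show "\<exists>d>0. \<forall>y. norm (y - x) < d \<longrightarrow>
            norm (A j y v - A j x v - ?L (y - x)) \<le> e * norm (y - x)" by blast
      qed
      then have "((\<lambda>y. nth_frechet_derivative j f y v) has_derivative ?L) (at x)"
        by (rule has_derivative_transform_within_open[OF _ \<open>open S\<close> x]) (simp add: IH)
      then have "frechet_derivative (\<lambda>y. nth_frechet_derivative j f y v) (at x) = ?L"
        by (metis frechet_derivative_at)
      then show ?thesis by simp
    qed
    then show ?case by blast
  qed
  then show ?thesis using \<open>x \<in> S\<close> by blast
qed

definition zero_of_order :: "nat \<Rightarrow> ('a::complex_banach \<Rightarrow> 'b::complex_banach) \<Rightarrow> bool"
  where "zero_of_order m g \<longleftrightarrow>
    g 0 = 0 \<and>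
    (\<forall>j. 1 \<le> j \<and> j < m \<longrightarrow> (\<forall>v. nth_frechet_derivative j g 0 v = 0)) \<and>
    (\<exists>v. nth_frechet_derivative m g 0 v \<noteq> 0)"

definition support_functionals :: "'a::complex_banach \<Rightarrow> ('a \<Rightarrow> complex) set"
  where "support_functionals z =
    {l. bounded_clinear l \<and> l z = complex_of_real (norm z) \<and> onorm l = 1}"

definition normalized_map :: "('a::complex_banach \<Rightarrow> 'a) \<Rightarrow> bool"
  where "normalized_map F \<longleftrightarrow> F 0 = 0 \<and> frechet_derivative F (at 0) = (\<lambda>v. v)"

definition has_bounded_inverse :: "('a::complex_banach \<Rightarrow> 'b::complex_banach) \<Rightarrow> bool"
  where "has_bounded_inverse L \<longleftrightarrow> bij L \<and> bounded_clinear (inv L)"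

definition locally_biholomorphic_on :: "('a::complex_banach \<Rightarrow> 'b::complex_banach) \<Rightarrow> 'a set \<Rightarrow> bool"
  where "locally_biholomorphic_on F S \<longleftrightarrow>
    holomorphic_map_on F S \<and> (\<forall>z\<in>S. has_bounded_inverse (frechet_derivative F (at z)))"

definition starlike_mapping :: "('a::complex_banach \<Rightarrow> 'a) \<Rightarrow> bool"
  where "starlike_mapping F \<longleftrightarrow>
    normalized_map F \<and> locally_biholomorphic_on F (ball 0 1) \<and>
    (\<forall>z\<in>ball 0 1 - {0}. \<forall>l\<in>support_functionals z.
       0 < Re (l (inv (frechet_derivative F (at z)) (F z))))"

definition taylor_coeff :: "('a::complex_banach \<Rightarrow> 'a) \<Rightarrow> 'a \<Rightarrow> ('a \<Rightarrow> complex) \<Rightarrow> nat \<Rightarrow> complex"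
  where "taylor_coeff F z l m =
    l (nth_frechet_derivative m F 0 (\<lambda>_. z)) / complex_of_real (fact m * norm z ^ m)"

end

theory Submission
  imports Defs "HOL-Complex_Analysis.Complex_Analysis"
begin

text \<open>
  On a complex line through a unit vector \<open>u\<close> the map \<open>F(z) = z f(z)\<close> restricts to \<open>s \<phi>(s) u\<close> with
  \<open>\<phi>(s) = f(su)\<close>; starlikeness makes \<open>p(s) = 1 + s \<phi>'(s) / \<phi>(s)\<close> a function with positive real part,
  and \<open>a\<^sub>m\<^sub>+\<^sub>1\<close> is the \<open>m\<close>-th Taylor coefficient of \<open>\<phi>\<close>. Comparing coefficients in
  \<open>(s \<phi>)' = p \<phi>\<close> expresses \<open>a\<^sub>k\<^sub>+\<^sub>1\<close> and \<open>a\<^sub>2\<^sub>k\<^sub>+\<^sub>1\<close> by the coefficients \<open>c\<^sub>k, c\<^sub>2\<^sub>k\<close> of \<open>p\<close>,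
  and the estimate \<open>|c\<^sub>2\<^sub>k - c\<^sub>k\<^sup>2/2| \<le> 2 - |c\<^sub>k|\<^sup>2/2\<close> bounds the determinant. Equality holds for
  \<open>f(z) = (1 - \<i> l(z)\<^sup>k)\<close> raised to the power \<open>-2/k\<close>, where \<open>l\<close> is a support functional of a unit vector.
\<close>

section \<open>Holomorphic functions on complex Banach spaces\<close>

text \<open>The form F(z) = z f(z) makes the problem scalar in two ways. The derivatives of F at 0
  on a tuple (z, ..., z) are multiples of z, so a_{m+1} depends only on f along the line of z,
  neither on l_z nor on the length of z. And DF(su) maps the line of u into itself, so its inverse
  can be computed there. Write A = a_{k+1} and B = a_{2k+1}. The bounds used for |B| and |B - 2A^2|
  are affine in |c_k|^2. The first increases; the second increases for k < 3 and decreases for k >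
  3, hence the case distinction. Up to k = 3 both are largest at |c_k| = 2, which a single mapping
  can realise; beyond it they peak at different places. The factor i in the extremal f gives c_k =
  2i, so A^2 is negative and the terms of 1 - 2A^2 - B (B - 2A^2) add up instead of cancelling. The
  analytic obstacle is that \<open>frechet_derivative\<close> is a choice operator: before any
  coefficient can be computed, the iterated derivatives of f on a Banach space must be shown to
  exist.\<close>

lemma scaleC_one [simp]: "1 *\<^sub>C x = x"
  using scaleC_of_real[of 1 x] by simp

text \<open>This makes the general product rule for bounded bilinear maps available for
  \<open>f z *\<^sub>C z\<close>.\<close>

lemma bounded_bilinear_scaleC: "bounded_bilinear (\<lambda>c x. c *\<^sub>C (x :: 'a :: complex_banach))"
proof
  show "(r *\<^sub>R c) *\<^sub>C x = r *\<^sub>R c *\<^sub>C x" for r c and x :: 'a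
    by (simp add: scaleR_conv_of_real scaleC_scaleC flip: scaleC_of_real)
  show "c *\<^sub>C r *\<^sub>R x = r *\<^sub>R c *\<^sub>C x" for r c and x :: 'a
    by (simp add: scaleC_scaleC mult.commute flip: scaleC_of_real)
  show "\<exists>K. \<forall>c (x :: 'a). norm (c *\<^sub>C x) \<le> norm c * norm x * K"
    by (rule exI[of _ 1]) (simp add: norm_scaleC)
qed (simp_all add: scaleC_add_left scaleC_add_right)

lemmas scaleC_zero_left [simp] = bounded_bilinear.zero_left[OF bounded_bilinear_scaleC]
  and scaleC_zero_right [simp] = bounded_bilinear.zero_right[OF bounded_bilinear_scaleC]
  and scaleC_diff_left = bounded_bilinear.diff_left[OF bounded_bilinear_scaleC]
  and scaleC_diff_right = bounded_bilinear.diff_right[OF bounded_bilinear_scaleC]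
  and scaleC_has_derivative = bounded_bilinear.FDERIV[OF bounded_bilinear_scaleC]

lemma scaleC_eq_0_iff [simp]: "c *\<^sub>C x = 0 \<longleftrightarrow> c = 0 \<or> x = 0"
  using norm_scaleC[of c x] by (metis norm_eq_zero mult_eq_0_iff)

lemma bounded_clinear_scaleC: "bounded_clinear L \<Longrightarrow> L (c *\<^sub>C x) = c *\<^sub>C L x"
  by (simp add: bounded_clinear_def)

lemma bounded_clinear_imp_bounded_linear: "bounded_clinear L \<Longrightarrow> bounded_linear L"
  by (simp add: bounded_clinear_def)

lemma holomorphic_map_onI:
  assumes "\<And>z. z \<in> S \<Longrightarrow> (F has_derivative L z) (at z)" and "\<And>z. z \<in> S \<Longrightarrow> bounded_clinear (L z)"
  shows "holomorphic_map_on F S"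
  using assms unfolding holomorphic_map_on_def by blast

lemma holomorphic_map_on_derivative:
  assumes "holomorphic_map_on F S" "z \<in> S"
  shows "(F has_derivative frechet_derivative F (at z)) (at z)"
    and "bounded_clinear (frechet_derivative F (at z))"
proof -
  obtain L where L: "bounded_clinear L" "(F has_derivative L) (at z)"
    using assms unfolding holomorphic_map_on_def by blast
  with frechet_derivative_at show "(F has_derivative frechet_derivative F (at z)) (at z)"
    and "bounded_clinear (frechet_derivative F (at z))" by metis+
qed

lemma has_field_derivative_along_line:
  fixes f :: "'a::complex_banach \<Rightarrow> complex"
  assumes f: "holomorphic_map_on f S" and s: "x + s *\<^sub>C v \<in> S"
  shows "((\<lambda>s. f (x + s *\<^sub>C v)) has_field_derivative frechet_derivative f (at (x + s *\<^sub>C v)) v) (at s)"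
proof -
  let ?D = "frechet_derivative f (at (x + s *\<^sub>C v))"
  have "((\<lambda>s. x + s *\<^sub>C v) has_derivative (\<lambda>h. h *\<^sub>C v)) (at s)"
    by (auto intro!: derivative_eq_intros scaleC_has_derivative)
  from diff_chain_at[OF this holomorphic_map_on_derivative(1)[OF f s]]
  have "((\<lambda>s. f (x + s *\<^sub>C v)) has_derivative (\<lambda>h. ?D (h *\<^sub>C v))) (at s)"
    by (simp add: o_def)
  moreover have "?D (h *\<^sub>C v) = ?D v * h" for h
    using bounded_clinear_scaleC[OF holomorphic_map_on_derivative(2)[OF f s]]
    by (simp add: scaleC_complex_def)
  ultimately show ?thesis by (simp add: has_field_derivative_def)
qed

lemma holomorphic_along_line:
  fixes f :: "'a::complex_banach \<Rightarrow> complex"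
  assumes "holomorphic_map_on f S" and "\<And>s. s \<in> T \<Longrightarrow> x + s *\<^sub>C v \<in> S"
  shows "(\<lambda>s. f (x + s *\<^sub>C v)) holomorphic_on T"
  unfolding holomorphic_on_def field_differentiable_def
  using has_field_derivative_along_line[OF assms(1)] assms(2) has_field_derivative_at_within by blast

section \<open>Cauchy estimates and differentiability of the derivative\<close>

lemma frechet_derivative_Cauchy_bound:
  fixes f :: "'a::complex_banach \<Rightarrow> complex"
  assumes f: "holomorphic_map_on f (ball x r)" and M: "\<And>y. y \<in> ball x r \<Longrightarrow> norm (f y) \<le> M"
    and r: "0 < r"
  shows "norm (frechet_derivative f (at x) h) \<le> 2 * M / r * norm h"
proof (cases "h = 0")
  case True
  have "linear (frechet_derivative f (at x))"
    using holomorphic_map_on_derivative(2)[OF f, of x] r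
    by (auto simp: bounded_clinear_def bounded_linear.linear)
  then show ?thesis using True by (simp add: linear_0)
next
  case False
  \<comment> \<open>Half the radius at which the line may leave the ball, so that the closed disc
    stays inside; the factor 2 of the bound comes from here.\<close>
  define \<rho> where "\<rho> = r / (2 * norm h)"
  have \<rho>: "\<rho> > 0" using False r by (simp add: \<rho>_def)
  have in_ball: "x + s *\<^sub>C h \<in> ball x r" if "s \<in> cball 0 \<rho>" for s
  proof -
    have "norm (s *\<^sub>C h) \<le> \<rho> * norm h"
      using that by (simp add: norm_scaleC mult_right_mono)
    also have "\<dots> < r" using r False by (simp add: \<rho>_def)
    finally show ?thesis by (simp add: dist_norm)
  qed
  have hol: "(\<lambda>s. f (x + s *\<^sub>C h)) holomorphic_on cball 0 \<rho>"
    by (rule holomorphic_along_line[OF f in_ball])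
  have "norm ((deriv ^^ 1) (\<lambda>s. f (x + s *\<^sub>C h)) 0) \<le> fact 1 * M / \<rho> ^ 1"
  proof (rule Cauchy_inequality)
    show "(\<lambda>s. f (x + s *\<^sub>C h)) holomorphic_on ball 0 \<rho>"
      using hol by (rule holomorphic_on_subset) auto
    show "continuous_on (cball 0 \<rho>) (\<lambda>s. f (x + s *\<^sub>C h))"
      using hol by (rule holomorphic_on_imp_continuous_on)
    show "norm (f (x + s *\<^sub>C h)) \<le> M" if "norm (0 - s) = \<rho>" for s
      using M in_ball[of s] that by auto
  qed (rule \<rho>)
  moreover have "deriv (\<lambda>s. f (x + s *\<^sub>C h)) 0 = frechet_derivative f (at x) h"
    using has_field_derivative_along_line[OF f, of x 0 h] r by (auto intro!: DERIV_imp_deriv)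
  ultimately show ?thesis using False r by (simp add: \<rho>_def field_simps)
qed

text \<open>The constant is Cauchy's estimate 2! M / (\<open>\<rho>\<close> / 2)^2 for the second
  derivative, inserted into Taylor's formula. It involves only \<open>M\<close> and
  \<open>\<rho>\<close>, so the error is uniform over families of functions with a common
  bound.\<close>

lemma difference_quotient_error:
  fixes \<psi> :: "complex \<Rightarrow> complex"
  assumes hol: "\<psi> holomorphic_on ball 0 (2 * \<rho>)" and M: "\<And>s. s \<in> ball 0 (2 * \<rho>) \<Longrightarrow> norm (\<psi> s) \<le> M"
    and t: "t \<in> ball 0 \<rho>" "t \<noteq> 0"
  shows "norm ((\<psi> t - \<psi> 0) / t - deriv \<psi> 0) \<le> 8 * M / \<rho>\<^sup>2 * norm t"
proof -
  have \<rho>: "\<rho> > 0" using t le_less_trans[OF norm_ge_zero, of t \<rho>] by simp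
  have "norm ((deriv ^^ 0) \<psi> t - (\<Sum>i\<le>1. (deriv ^^ i) \<psi> 0 * (t - 0) ^ i / fact i))
      \<le> (8 * M / \<rho>\<^sup>2) * norm (t - 0) ^ Suc 1 / fact 1"
  proof (rule complex_Taylor[where f = "\<lambda>i. (deriv ^^ i) \<psi>" and S = "ball 0 \<rho>"])
    show "convex (ball (0 :: complex) \<rho>)" by simp
    show "((deriv ^^ i) \<psi> has_field_derivative (deriv ^^ Suc i) \<psi> s) (at s within ball 0 \<rho>)"
      if "s \<in> ball 0 \<rho>" for i s
    proof -
      have "s \<in> ball 0 (2 * \<rho>)" using that \<rho> by simp
      from has_field_derivative_higher_deriv[OF hol _ this]
      show ?thesis by (simp add: has_field_derivative_at_within)
    qed
    show "norm ((deriv ^^ Suc 1) \<psi> s) \<le> 8 * M / \<rho>\<^sup>2" if s: "s \<in> ball 0 \<rho>" for s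
    proof -
      have sub: "cball s (\<rho> / 2) \<subseteq> ball 0 (2 * \<rho>)"
      proof
        fix w assume "w \<in> cball s (\<rho> / 2)"
        then have "norm (s - w) \<le> \<rho> / 2" by (simp add: dist_norm)
        moreover have "norm w \<le> norm s + norm (s - w)"
          by (metis norm_minus_commute norm_triangle_sub)
        moreover have "norm s < \<rho>" using s by simp
        ultimately show "w \<in> ball 0 (2 * \<rho>)" using \<rho> by simp
      qed
      have "norm ((deriv ^^ 2) \<psi> s) \<le> fact 2 * M / (\<rho> / 2) ^ 2"
      proof (rule Cauchy_inequality)
        show "\<psi> holomorphic_on ball s (\<rho> / 2)"
          using hol by (rule holomorphic_on_subset) (use sub ball_subset_cball in blast)
        show "continuous_on (cball s (\<rho> / 2)) \<psi>"
          using hol sub holomorphic_on_imp_continuous_on continuous_on_subset by blast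
        show "norm (\<psi> w) \<le> M" if "norm (s - w) = \<rho> / 2" for w
          by (rule M, rule subsetD[OF sub]) (use that in \<open>simp add: dist_norm\<close>)
      qed (use \<rho> in simp)
      then show ?thesis by (simp add: numeral_2_eq_2 power2_eq_square field_simps)
    qed
  qed (use t \<rho> in auto)
  then have "norm (\<psi> t - \<psi> 0 - deriv \<psi> 0 * t) \<le> 8 * M / \<rho>\<^sup>2 * norm t * norm t"
    by (simp add: power2_eq_square algebra_simps)
  moreover have "(\<psi> t - \<psi> 0) / t - deriv \<psi> 0 = (\<psi> t - \<psi> 0 - deriv \<psi> 0 * t) / t"
    using t by (simp add: field_simps)
  ultimately show ?thesis using t by (simp add: norm_divide divide_le_eq)
qed

text \<open>
  The derivative \<open>y \<mapsto> Df(y)v\<close> is a uniform limit of difference quotients of \<open>f\<close> in the direction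
  \<open>v\<close>, and by Cauchy's estimate the derivatives of these quotients converge uniformly too.
\<close>

lemma holomorphic_map_on_frechet_derivative:
  fixes f :: "'a::complex_banach \<Rightarrow> complex"
  assumes f: "holomorphic_map_on f S" and S: "open S"
  shows "holomorphic_map_on (\<lambda>y. frechet_derivative f (at y) v) S"
  unfolding holomorphic_map_on_def
proof
  fix x assume x: "x \<in> S"
  obtain R0 where R0: "R0 > 0" "ball x R0 \<subseteq> S"
    using S x by (auto simp: open_contains_ball)
  \<comment> \<open>Continuity at \<open>x\<close> supplies a bound for \<open>f\<close> on a whole
    ball, since compactness of closed balls is not at hand in a Banach space.\<close>
  have "isCont f x"
    using holomorphic_map_on_derivative(1)[OF f x] has_derivative_continuous by blast
  then obtain R1 where R1: "R1 > 0" "\<And>y. dist y x < R1 \<Longrightarrow> dist (f y) (f x) < 1"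
    unfolding continuous_at_eps_delta by (metis zero_less_one)
  define R where "R = min R0 R1"
  define M where "M = norm (f x) + 1"
  have R: "R > 0" and RS: "ball x R \<subseteq> S" using R0 R1 by (auto simp: R_def)
  have M: "norm (f y) \<le> M" if "y \<in> ball x R" for y
  proof -
    have "dist (f y) (f x) < 1" using R1(2)[of y] that by (simp add: R_def dist_commute)
    then show ?thesis unfolding M_def dist_norm by (smt (verit) norm_triangle_ineq2)
  qed
  have M0: "M > 0" unfolding M_def by (simp add: add_nonneg_pos)
  \<comment> \<open>Moves of parameter length below 2 \<open>\<rho>\<close> along \<open>v\<close>
    change a point by at most R/2 and so lead from the half ball into the full one; the summand 1
    covers \<open>v = 0\<close>.\<close>
  define \<rho> where "\<rho> = R / (4 * (norm v + 1))"
  have v1: "norm v + 1 > 0" by (simp add: add_nonneg_pos)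
  have \<rho>: "\<rho> > 0" using R v1 by (simp add: \<rho>_def)
  have step: "y + s *\<^sub>C v \<in> ball x R" if "y \<in> ball x (R / 2)" "s \<in> ball 0 (2 * \<rho>)" for y s
  proof -
    have "norm (s *\<^sub>C v) \<le> 2 * \<rho> * (norm v + 1)"
      unfolding norm_scaleC using that(2) \<rho> by (intro mult_mono) auto
    also have "\<dots> = R / 2" using v1 by (simp add: \<rho>_def field_simps)
    finally have "norm (s *\<^sub>C v) \<le> R / 2" .
    moreover have "dist x y < R / 2" using that(1) by simp
    moreover have "dist x (y + s *\<^sub>C v) \<le> dist x y + norm (s *\<^sub>C v)"
      by (metis add_diff_cancel_left' dist_norm dist_triangle norm_minus_commute)
    ultimately show ?thesis by simp
  qed
  define K where "K = 8 * M / \<rho>\<^sup>2"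
  have K: "K > 0" using M0 \<rho> by (simp add: K_def)
  define t where "t n = \<rho> / (real n + 2)" for n
  have t: "t n > 0" "t n < \<rho>" for n using \<rho> by (auto simp: t_def field_simps intro!: add_pos_nonneg)
  define c where "c n = complex_of_real (t n)" for n
  have c: "c n \<in> ball 0 \<rho>" "c n \<noteq> 0" "norm (c n) = t n" and c2: "c n \<in> ball 0 (2 * \<rho>)" for n
    using t[of n] by (auto simp: c_def)
  define \<Phi> where "\<Phi> n y = (f (y + c n *\<^sub>C v) - f y) / c n" for n y
  define G where "G y = frechet_derivative f (at y) v" for y
  have y_in: "y \<in> ball x R" if "y \<in> ball x (R / 2)" for y
    using step[OF that, of 0] \<rho> by simp
  have err: "norm (\<Phi> n y - G y) \<le> K * t n" if y: "y \<in> ball x (R / 2)" for n y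
  proof -
    let ?\<psi> = "\<lambda>s. f (y + s *\<^sub>C v)"
    have "norm ((?\<psi> (c n) - ?\<psi> 0) / c n - deriv ?\<psi> 0) \<le> 8 * M / \<rho>\<^sup>2 * norm (c n)"
    proof (rule difference_quotient_error)
      show "?\<psi> holomorphic_on ball 0 (2 * \<rho>)"
        using step[OF y] RS by (intro holomorphic_along_line[OF f]) blast
    qed (use c M step[OF y] in auto)
    moreover have "deriv ?\<psi> 0 = G y"
      using has_field_derivative_along_line[OF f, of y 0 v] y_in[OF y] RS
      by (auto intro!: DERIV_imp_deriv simp: G_def)
    ultimately show ?thesis by (simp add: \<Phi>_def K_def c)
  qed
  define \<Phi>' where "\<Phi>' n y h =
    (frechet_derivative f (at (y + c n *\<^sub>C v)) h - frechet_derivative f (at y) h) / c n" for n y h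
  have der: "(\<Phi> n has_derivative \<Phi>' n y) (at y)" and lin: "bounded_clinear (\<Phi>' n y)"
    if y: "y \<in> ball x (R / 2)" for n y
  proof -
    have yS: "y + c n *\<^sub>C v \<in> S" "y \<in> S" using step[OF y c2] y_in[OF y] RS by auto
    have shift: "((\<lambda>y. y + c n *\<^sub>C v) has_derivative (\<lambda>h. h)) (at y)"
      by (auto intro!: derivative_eq_intros)
    have "((\<lambda>y. f (y + c n *\<^sub>C v)) has_derivative frechet_derivative f (at (y + c n *\<^sub>C v))) (at y)"
      using diff_chain_at[OF shift holomorphic_map_on_derivative(1)[OF f yS(1)]] by (simp add: o_def)
    from has_derivative_divide'[OF has_derivative_diff[OF this holomorphic_map_on_derivative(1)[OF f yS(2)]]
          has_derivative_const c(2)[of n]]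
    show der: "(\<Phi> n has_derivative \<Phi>' n y) (at y)"
      using c(2)[of n] by (simp add: \<Phi>_def[abs_def] \<Phi>'_def[abs_def])
    show "bounded_clinear (\<Phi>' n y)"
      unfolding bounded_clinear_def
      using has_derivative_bounded_linear[OF der]
        bounded_clinear_scaleC[OF holomorphic_map_on_derivative(2)[OF f yS(1)]]
        bounded_clinear_scaleC[OF holomorphic_map_on_derivative(2)[OF f yS(2)]]
      by (simp add: \<Phi>'_def scaleC_complex_def algebra_simps diff_divide_distrib)
  qed
  let ?B = "ball x (R / 4)"
  have B: "ball y (R / 4) \<subseteq> ball x (R / 2)" if "y \<in> ?B" for y
  proof
    fix w assume "w \<in> ball y (R / 4)"
    then show "w \<in> ball x (R / 2)" using that dist_triangle[of x w y] by simp
  qed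
  \<comment> \<open>Cauchy's estimate on balls of radius R/4, applied to
    \<open>\<Phi> n - \<Phi> m\<close>, which is bounded there by K (t n + t m): uniform closeness
    of the quotients becomes closeness of their derivatives in operator norm.\<close>
  have cau: "norm (\<Phi>' n y h - \<Phi>' m y h) \<le> 8 * K / R * (t n + t m) * norm h" if y: "y \<in> ?B" for n m y h
  proof -
    let ?d = "\<lambda>y. \<Phi> n y - \<Phi> m y" and ?d' = "\<lambda>y h. \<Phi>' n y h - \<Phi>' m y h"
    have d: "(?d has_derivative ?d' w) (at w)" if "w \<in> ball y (R / 4)" for w
      using der B[OF y] that by (auto intro!: has_derivative_diff)
    have "holomorphic_map_on ?d (ball y (R / 4))"
    proof (rule holomorphic_map_onI[OF d])
      show "bounded_clinear (?d' w)" if w: "w \<in> ball y (R / 4)" for w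
        using has_derivative_bounded_linear[OF d[OF w]] lin[THEN bounded_clinear_scaleC, of w]
          B[OF y] w unfolding bounded_clinear_def by (auto simp: scaleC_diff_right)
    qed
    moreover have "norm (?d w) \<le> K * t n + K * t m" if "w \<in> ball y (R / 4)" for w
      using err[of w n] err[of w m] B[OF y] that norm_triangle_ineq4[of "\<Phi> n w - G w" "\<Phi> m w - G w"]
      by force
    ultimately have "norm (frechet_derivative ?d (at y) h) \<le> 2 * (K * t n + K * t m) / (R / 4) * norm h"
      using R by (intro frechet_derivative_Cauchy_bound) auto
    moreover have "frechet_derivative ?d (at y) = ?d' y"
      using frechet_derivative_at[OF d[of y]] R by simp
    ultimately show ?thesis by (simp add: algebra_simps)
  qed
  have t0: "t \<longlonglongrightarrow> 0" unfolding t_def by real_asymp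
  have "Cauchy (\<lambda>n. \<Phi>' n y h)" if y: "y \<in> ?B" for y h
  proof (rule metric_CauchyI)
    fix e :: real assume e: "e > 0"
    have "(\<lambda>n. 8 * K / R * (t n + t n) * norm h) \<longlonglongrightarrow> 8 * K / R * (0 + 0) * norm h"
      by (intro tendsto_intros t0)
    then have "\<forall>\<^sub>F n in sequentially. 8 * K / R * (t n + t n) * norm h < e"
      by (rule order_tendstoD(2)) (use e in simp)
    then obtain N where N: "8 * K / R * (t N + t N) * norm h < e"
      by (auto simp: eventually_sequentially)
    have anti: "t n \<le> t N" if "n \<ge> N" for n
      using that \<rho> unfolding t_def by (intro divide_left_mono) auto
    show "\<exists>N. \<forall>m\<ge>N. \<forall>n\<ge>N. dist (\<Phi>' m y h) (\<Phi>' n y h) < e"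
    proof (intro exI allI impI)
      fix m n assume mn: "m \<ge> N" "n \<ge> N"
      have "dist (\<Phi>' m y h) (\<Phi>' n y h) \<le> 8 * K / R * (t m + t n) * norm h"
        using cau[OF y] by (simp add: dist_norm)
      also have "\<dots> \<le> 8 * K / R * (t N + t N) * norm h"
        using anti[OF mn(1)] anti[OF mn(2)] K R by (intro mult_right_mono mult_left_mono add_mono) auto
      finally show "dist (\<Phi>' m y h) (\<Phi>' n y h) < e" using N by simp
    qed
  qed
  then have "\<exists>g'. \<forall>y\<in>?B. \<forall>h. (\<lambda>n. \<Phi>' n y h) \<longlonglongrightarrow> g' y h"
    by (intro exI[of _ "\<lambda>y h. lim (\<lambda>n. \<Phi>' n y h)"])
      (auto simp: convergent_LIMSEQ_iff[symmetric] Cauchy_convergent_iff)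
  then obtain g' where g': "\<And>y h. y \<in> ?B \<Longrightarrow> (\<lambda>n. \<Phi>' n y h) \<longlonglongrightarrow> g' y h" by blast
  have g'_err: "norm (\<Phi>' n y h - g' y h) \<le> 8 * K / R * t n * norm h" if y: "y \<in> ?B" for n y h
  proof (rule LIMSEQ_le)
    show "(\<lambda>m. norm (\<Phi>' n y h - \<Phi>' m y h)) \<longlonglongrightarrow> norm (\<Phi>' n y h - g' y h)"
      by (intro tendsto_intros g' y)
    have "(\<lambda>m. 8 * K / R * (t n + t m) * norm h) \<longlonglongrightarrow> 8 * K / R * (t n + 0) * norm h"
      by (intro tendsto_intros t0)
    then show "(\<lambda>m. 8 * K / R * (t n + t m) * norm h) \<longlonglongrightarrow> 8 * K / R * t n * norm h" by simp
  qed (use cau[OF y] in blast)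
  have x_in: "x \<in> ?B" using R by simp
  have G_lim: "(\<lambda>n. \<Phi> n y) \<longlonglongrightarrow> G y" if "y \<in> ball x (R / 2)" for y
  proof -
    have "(\<lambda>n. K * t n) \<longlonglongrightarrow> K * 0" by (intro tendsto_intros t0)
    then have "(\<lambda>n. K * t n) \<longlonglongrightarrow> 0" by simp
    with always_eventually[OF allI[OF err[OF that]]] have "(\<lambda>n. \<Phi> n y - G y) \<longlonglongrightarrow> 0"
      by (rule Lim_null_comparison)
    then show ?thesis by (rule LIM_zero_cancel)
  qed
  have "\<exists>g. \<forall>y\<in>?B. (\<lambda>n. \<Phi> n y) \<longlonglongrightarrow> g y \<and> (g has_derivative g' y) (at y within ?B)"
  proof (rule has_derivative_sequence[OF _ _ _ x_in])
    show "(\<Phi> n has_derivative \<Phi>' n y) (at y within ?B)" if "y \<in> ?B" for n y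
      by (rule has_derivative_at_withinI[OF der]) (use that R in simp)
    show "\<forall>\<^sub>F n in sequentially. \<forall>y\<in>?B. \<forall>h. norm (\<Phi>' n y h - g' y h) \<le> e * norm h" if e: "e > 0" for e
    proof -
      have "(\<lambda>n. 8 * K / R * t n) \<longlonglongrightarrow> 8 * K / R * 0" by (intro tendsto_intros t0)
      then have "\<forall>\<^sub>F n in sequentially. 8 * K / R * t n < e"
        using order_tendstoD(2) e by fastforce
      then show ?thesis
      proof eventually_elim
        case (elim n)
        then have "8 * K / R * t n * norm h \<le> e * norm h" for h :: 'a
          by (intro mult_right_mono) auto
        with g'_err show ?case by (meson order_trans)
      qed
    qed
    show "(\<lambda>n. \<Phi> n x) \<longlonglongrightarrow> G x" using R by (intro G_lim) simp
  qed simp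
  then obtain g where g: "\<And>y. y \<in> ?B \<Longrightarrow> (\<lambda>n. \<Phi> n y) \<longlonglongrightarrow> g y" "(g has_derivative g' x) (at x within ?B)"
    using x_in by blast
  have "g y = G y" if y: "y \<in> ?B" for y
    using LIMSEQ_unique[OF g(1)[OF y] G_lim] y R by simp
  then have G': "(G has_derivative g' x) (at x)"
    using has_derivative_transform_within_open[of g "g' x" x UNIV ?B G] g(2) x_in
    by (auto simp: at_within_open[OF x_in])
  have "g' x (a *\<^sub>C h) = a *\<^sub>C g' x h" for a h
  proof (rule LIMSEQ_unique[OF g'[OF x_in]])
    have "\<Phi>' n x (a *\<^sub>C h) = a * \<Phi>' n x h" for n
      using bounded_clinear_scaleC[OF lin[of x n]] R by (simp add: scaleC_complex_def)
    then show "(\<lambda>n. \<Phi>' n x (a *\<^sub>C h)) \<longlonglongrightarrow> a *\<^sub>C g' x h"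
      by (simp add: scaleC_complex_def tendsto_mult_left[OF g'[OF x_in]])
  qed
  then have "bounded_clinear (g' x)"
    using has_derivative_bounded_linear[OF G'] by (simp add: bounded_clinear_def)
  with G' show "\<exists>L. bounded_clinear L \<and> ((\<lambda>y. frechet_derivative f (at y) v) has_derivative L) (at x)"
    by (auto simp: G_def[abs_def])
qed

section \<open>Coefficients of functions with positive real part\<close>

text \<open>With u = r e^{it}, the first integral is Cauchy's formula for the n-th derivative and
  the second is Cauchy's theorem for p(u) u^{n-1}. Against a holomorphic function only one half of
  the frequencies survives.\<close>

lemma has_integral_circle_Fourier:
  fixes p :: "complex \<Rightarrow> complex"
  assumes p: "p holomorphic_on ball 0 1" and r: "0 < r" "r < 1"
  shows "((\<lambda>t. p (of_real r * cis t) * cis (- real n * t)) has_integral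
           2 * pi * of_real r ^ n * ((deriv ^^ n) p 0 / fact n)) {0..2 * pi}"
    and "0 < n \<Longrightarrow> ((\<lambda>t. p (of_real r * cis t) * cis (real n * t)) has_integral 0) {0..2 * pi}"
proof -
  have sub: "cball 0 r \<subseteq> ball 0 1" using r by auto
  have hol: "p holomorphic_on ball 0 r"
    using p by (rule holomorphic_on_subset) (use r in auto)
  have cont: "continuous_on (cball 0 r) p"
    using holomorphic_on_subset[OF p sub] by (rule holomorphic_on_imp_continuous_on)
  have "((\<lambda>u. p u / (u - 0) ^ Suc n) has_contour_integral
          2 * pi * \<i> / fact n * (deriv ^^ n) p 0) (circlepath 0 r)"
    by (rule Cauchy_has_contour_integral_higher_derivative_circlepath[OF cont hol]) (use r in auto)
  then have "((\<lambda>t. p (of_real r * cis t) / (of_real r * cis t) ^ Suc n * of_real r * \<i> * cis t)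
        has_integral 2 * pi * \<i> / fact n * (deriv ^^ n) p 0) {0..2 * pi}"
    unfolding circlepath_def has_contour_integral_part_circlepath_iff[of 0 "2 * pi", simplified]
    by simp
  from has_integral_mult_right[OF this, of "of_real r ^ n / \<i>"]
  have "((\<lambda>t. of_real r ^ n / \<i> * (p (of_real r * cis t) / (of_real r * cis t) ^ Suc n * of_real r * \<i> * cis t))
        has_integral 2 * pi * of_real r ^ n * ((deriv ^^ n) p 0 / fact n)) {0..2 * pi}"
    by (simp add: field_simps)
  moreover have "of_real r ^ n / \<i> * (p (of_real r * cis t) / (of_real r * cis t) ^ Suc n * of_real r * \<i> * cis t)
      = p (of_real r * cis t) * cis (- real n * t)" for t
  proof -
    have "cis (- real n * t) = inverse (cis t ^ n)"
      by (simp add: Complex.DeMoivre cis_inverse)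
    then show ?thesis using r by (simp add: field_simps)
  qed
  ultimately show "((\<lambda>t. p (of_real r * cis t) * cis (- real n * t)) has_integral
           2 * pi * of_real r ^ n * ((deriv ^^ n) p 0 / fact n)) {0..2 * pi}"
    by simp
  assume n: "0 < n"
  \<comment> \<open>One of the \<open>n\<close> factors e^{it} is supplied by du, so the integrand
    carries only the power n - 1.\<close>
  then obtain m where m: "n = Suc m" using gr0_implies_Suc by blast
  have "((\<lambda>u. p u * u ^ m) has_contour_integral 0) (circlepath 0 r)"
  proof (rule Cauchy_theorem_convex_simple)
    show "(\<lambda>u. p u * u ^ m) holomorphic_on ball 0 1" by (intro holomorphic_intros p)
  qed (use r in auto)
  then have "((\<lambda>t. p (of_real r * cis t) * (of_real r * cis t) ^ m * of_real r * \<i> * cis t)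
        has_integral 0) {0..2 * pi}"
    unfolding circlepath_def has_contour_integral_part_circlepath_iff[of 0 "2 * pi", simplified]
    by simp
  from has_integral_mult_right[OF this, of "1 / (of_real r ^ n * \<i>)"]
  have "((\<lambda>t. 1 / (of_real r ^ n * \<i>) * (p (of_real r * cis t) * (of_real r * cis t) ^ m * of_real r * \<i> * cis t))
        has_integral 0) {0..2 * pi}"
    by simp
  moreover have "1 / (of_real r ^ n * \<i>) * (p (of_real r * cis t) * (of_real r * cis t) ^ m * of_real r * \<i> * cis t)
      = p (of_real r * cis t) * cis (real n * t)" for t
  proof -
    have "cis (real n * t) = cis t ^ n" by (simp add: Complex.DeMoivre)
    then show ?thesis using r by (simp add: m power_mult_distrib field_simps)
  qed
  ultimately show "((\<lambda>t. p (of_real r * cis t) * cis (real n * t)) has_integral 0) {0..2 * pi}"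
    by simp
qed

text \<open>
  The positive weight \<open>Re p\<close> is integrated against \<open>|x + y e\<^bsup>ikt\<^esup> + z e\<^bsup>2ikt\<^esup>|\<^sup>2\<close> over a circle of radius \<open>r\<close>.
\<close>

lemma Toeplitz_form_nonneg_circle:
  fixes p :: "complex \<Rightarrow> complex" and x y z :: complex
  assumes p: "p holomorphic_on ball 0 1" and pos: "\<And>s. s \<in> ball 0 1 \<Longrightarrow> 0 < Re (p s)"
    and r: "0 < r" "r < 1" and k: "0 < k"
  defines "c \<equiv> (\<lambda>n. (deriv ^^ n) p 0 / fact n)"
  shows "0 \<le> Re (c 0 * (x * cnj x + y * cnj y + z * cnj z)
      + of_real r ^ k * c k * (x * cnj y + y * cnj z) + of_real r ^ (2 * k) * c (2 * k) * (x * cnj z))"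
proof -
  let ?P = "\<lambda>t. p (of_real r * cis t)" and ?e = "\<lambda>n t. cis (real n * t)"
  let ?q = "\<lambda>t. x + y * ?e k t + z * ?e (2 * k) t"
  let ?S = "c 0 * (x * cnj x + y * cnj y + z * cnj z)
      + of_real r ^ k * c k * (x * cnj y + y * cnj z) + of_real r ^ (2 * k) * c (2 * k) * (x * cnj z)"
  note F = has_integral_circle_Fourier[OF p r]
  \<comment> \<open>The five groups are the frequencies 0, -k, -2k, k, 2k in the expansion of
    \<open>?q t * cnj (?q t)\<close>; the last two integrate to 0 against \<open>p\<close>.\<close>
  have "((\<lambda>t. (x * cnj x + y * cnj y + z * cnj z) * (?P t * cis (- real 0 * t))
       + (x * cnj y + y * cnj z) * (?P t * cis (- real k * t))
       + (x * cnj z) * (?P t * cis (- real (2 * k) * t))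
       + (y * cnj x + z * cnj y) * (?P t * ?e k t) + (z * cnj x) * (?P t * ?e (2 * k) t))
      has_integral
       ((x * cnj x + y * cnj y + z * cnj z) * (2 * pi * of_real r ^ 0 * ((deriv ^^ 0) p 0 / fact 0))
       + (x * cnj y + y * cnj z) * (2 * pi * of_real r ^ k * ((deriv ^^ k) p 0 / fact k))
       + (x * cnj z) * (2 * pi * of_real r ^ (2 * k) * ((deriv ^^ (2 * k)) p 0 / fact (2 * k)))
       + (y * cnj x + z * cnj y) * 0 + (z * cnj x) * 0)) {0..2 * pi}"
    by (intro has_integral_add has_integral_mult_right F) (use k in auto)
  moreover have "(x * cnj x + y * cnj y + z * cnj z) * (?P t * cis (- real 0 * t))
       + (x * cnj y + y * cnj z) * (?P t * cis (- real k * t))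
       + (x * cnj z) * (?P t * cis (- real (2 * k) * t))
       + (y * cnj x + z * cnj y) * (?P t * ?e k t) + (z * cnj x) * (?P t * ?e (2 * k) t)
      = ?P t * (?q t * cnj (?q t))" for t
  proof -
    define w where "w = cis (real k * t)"
    have w2: "?e (2 * k) t = w * w" by (simp add: w_def cis_mult algebra_simps)
    have w1: "w * cnj w = 1" by (simp add: w_def cis_cnj cis_mult)
    have e: "cis (- real k * t) = cnj w" "cis (- real (2 * k) * t) = cnj w * cnj w"
      by (simp_all add: w_def cis_cnj cis_mult algebra_simps)
    have "w \<noteq> 0" by (simp add: w_def)
    then have cw: "cnj w = 1 / w" using w1 by (simp add: field_simps)
    show ?thesis
      unfolding e w2 w_def[symmetric] using \<open>w \<noteq> 0\<close> by (simp add: cw field_simps)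
  qed
  moreover have "(x * cnj x + y * cnj y + z * cnj z) * (2 * pi * of_real r ^ 0 * ((deriv ^^ 0) p 0 / fact 0))
       + (x * cnj y + y * cnj z) * (2 * pi * of_real r ^ k * ((deriv ^^ k) p 0 / fact k))
       + (x * cnj z) * (2 * pi * of_real r ^ (2 * k) * ((deriv ^^ (2 * k)) p 0 / fact (2 * k)))
       + (y * cnj x + z * cnj y) * 0 + (z * cnj x) * 0 = of_real (2 * pi) * ?S"
    unfolding c_def by (simp add: algebra_simps)
  ultimately have "((\<lambda>t. ?P t * (?q t * cnj (?q t))) has_integral of_real (2 * pi) * ?S) {0..2 * pi}"
    by simp
  from has_integral_linear[OF this bounded_linear_Re]
  have "((\<lambda>t. Re (?P t * (?q t * cnj (?q t)))) has_integral Re (of_real (2 * pi) * ?S)) {0..2 * pi}"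
    by (simp only: o_def)
  moreover have "Re (of_real (2 * pi) * w) = 2 * pi * Re w" for w by simp
  ultimately have "((\<lambda>t. Re (?P t * (?q t * cnj (?q t)))) has_integral 2 * pi * Re ?S) {0..2 * pi}"
    by (simp only:)
  moreover have "0 \<le> Re (?P t * (?q t * cnj (?q t)))" for t
  proof -
    have "0 \<le> Re (?P t) * (norm (?q t))\<^sup>2"
      using pos[of "of_real r * cis t"] r by (simp add: norm_mult less_imp_le)
    also have "\<dots> = Re (?P t * of_real ((norm (?q t))\<^sup>2))" by simp
    finally show ?thesis unfolding complex_norm_square .
  qed
  ultimately have "0 \<le> 2 * pi * Re ?S" by (rule has_integral_nonneg)
  then show ?thesis using pi_gt_zero unfolding zero_le_mult_iff[of "2 * pi"] by linarith
qed

text \<open>The limit r -> 1 is taken in the quadratic form, which contains just three coefficients,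
  so \<open>p\<close> needs no boundary values.\<close>

lemma Toeplitz_form_nonneg:
  fixes p :: "complex \<Rightarrow> complex" and x y z :: complex
  assumes p: "p holomorphic_on ball 0 1" and pos: "\<And>s. s \<in> ball 0 1 \<Longrightarrow> 0 < Re (p s)" and k: "0 < k"
  defines "c \<equiv> (\<lambda>n. (deriv ^^ n) p 0 / fact n)"
  shows "0 \<le> Re (c 0 * (x * cnj x + y * cnj y + z * cnj z)
      + c k * (x * cnj y + y * cnj z) + c (2 * k) * (x * cnj z))"
proof (rule tendsto_lowerbound)
  let ?S = "\<lambda>r. Re (c 0 * (x * cnj x + y * cnj y + z * cnj z)
      + of_real r ^ k * c k * (x * cnj y + y * cnj z) + of_real r ^ (2 * k) * c (2 * k) * (x * cnj z))"
  have "(?S \<longlongrightarrow> ?S 1) (at_left 1)"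
    by (intro tendsto_intros)
  then show "(?S \<longlongrightarrow> Re (c 0 * (x * cnj x + y * cnj y + z * cnj z)
      + c k * (x * cnj y + y * cnj z) + c (2 * k) * (x * cnj z))) (at_left 1)" by simp
  have "\<forall>\<^sub>F r in at_left 1. r \<in> {0<..<1::real}"
    by (intro eventually_at_left_real) simp
  then show "\<forall>\<^sub>F r in at_left 1. 0 \<le> ?S r"
  proof eventually_elim
    case (elim r)
    then show ?case
      using Toeplitz_form_nonneg_circle[OF p pos _ _ k, of r x y z] unfolding c_def by simp
  qed
qed simp

text \<open>
  With \<open>\<gamma> = c\<^sub>k / 2\<close> and \<open>\<delta> = c\<^sub>2\<^sub>k / 2\<close> the Toeplitz matrix of \<open>1, \<gamma>, \<delta>\<close> is positive semidefinite;
  the choice of \<open>y\<close> below amounts to taking the Schur complement of its middle entry.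
\<close>

lemma Caratheodory_coeff_bounds:
  fixes p :: "complex \<Rightarrow> complex"
  assumes p: "p holomorphic_on ball 0 1" and pos: "\<And>s. s \<in> ball 0 1 \<Longrightarrow> 0 < Re (p s)" and k: "0 < k"
    and p0: "p 0 = 1"
    and \<gamma>: "\<gamma> = (deriv ^^ k) p 0 / fact k / 2" and \<delta>: "\<delta> = (deriv ^^ (2 * k)) p 0 / fact (2 * k) / 2"
  shows "norm \<gamma> \<le> 1" and "norm (\<delta> - \<gamma>\<^sup>2) \<le> 1 - (norm \<gamma>)\<^sup>2"
proof -
  have T: "0 \<le> Re (x * cnj x + y * cnj y + z * cnj z
      + 2 * \<gamma> * (x * cnj y + y * cnj z) + 2 * \<delta> * (x * cnj z))" for x y z
  proof -
    have "(deriv ^^ k) p 0 / fact k = 2 * \<gamma>" "(deriv ^^ (2 * k)) p 0 / fact (2 * k) = 2 * \<delta>"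
      by (simp_all add: \<gamma> \<delta>)
    with Toeplitz_form_nonneg[OF p pos k, of x y z] show ?thesis
      by (simp only: p0 funpow_0 fact_0 div_by_1 mult_1)
  qed
  have schur: "0 \<le> (1 - (norm \<gamma>)\<^sup>2) * ((norm x)\<^sup>2 + (norm z)\<^sup>2) + 2 * Re ((\<delta> - \<gamma>\<^sup>2) * (x * cnj z))" for x z
  proof -
    define y where "y = - (\<gamma> * x + cnj \<gamma> * z)"
    have "Re (x * cnj x + y * cnj y + z * cnj z + 2 * \<gamma> * (x * cnj y + y * cnj z) + 2 * \<delta> * (x * cnj z))
      = (1 - (norm \<gamma>)\<^sup>2) * ((norm x)\<^sup>2 + (norm z)\<^sup>2) + 2 * Re ((\<delta> - \<gamma>\<^sup>2) * (x * cnj z))"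
      unfolding y_def cmod_power2 by (simp add: power2_eq_square) algebra
    with T[of x y z] show ?thesis by (simp only:)
  qed
  from schur[of 1 0] have "(norm \<gamma>)\<^sup>2 \<le> 1" by simp
  then show "norm \<gamma> \<le> 1" using power2_le_imp_le[of "norm \<gamma>" 1] by simp
  define w where "w = \<delta> - \<gamma>\<^sup>2"
  show "norm (\<delta> - \<gamma>\<^sup>2) \<le> 1 - (norm \<gamma>)\<^sup>2"
  proof (cases "w = 0")
    case True
    then show ?thesis using \<open>(norm \<gamma>)\<^sup>2 \<le> 1\<close> by (simp add: w_def)
  next
    case False
    \<comment> \<open>The unimodular number that rotates \<open>w\<close> to the negative real axis,
      where the mixed term of \<open>schur\<close> is smallest.\<close>
    define x where "x = - cnj w / of_real (norm w)"
    have "w * (x * cnj 1) = - (w * cnj w) / of_real (norm w)" by (simp add: x_def)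
    also have "\<dots> = of_real (- norm w)"
      using False by (simp add: complex_norm_square[symmetric] power2_eq_square)
    finally have "Re (w * (x * cnj 1)) = - norm w" by (simp only: Re_complex_of_real)
    moreover have "norm x = 1" using False by (simp add: x_def norm_divide)
    ultimately have "0 \<le> (1 - (norm \<gamma>)\<^sup>2) * (1\<^sup>2 + 1\<^sup>2) + 2 * (- norm w)"
      using schur[of x 1] unfolding w_def[symmetric] by (simp only: norm_one)
    then show ?thesis by (simp add: w_def)
  qed
qed

section \<open>Coefficients of the logarithmic derivative and the determinant estimate\<close>

lemma logderiv_coeff_recurrence:
  fixes \<phi> p :: "complex \<Rightarrow> complex"
  assumes \<phi>: "\<phi> holomorphic_on ball 0 1" and p: "p holomorphic_on ball 0 1"
    and eq: "\<And>s. s \<in> ball 0 1 \<Longrightarrow> \<phi> s + s * deriv \<phi> s = p s * \<phi> s"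
  defines "b \<equiv> (\<lambda>n. (deriv ^^ n) \<phi> 0 / fact n)" and "c \<equiv> (\<lambda>n. (deriv ^^ n) p 0 / fact n)"
  shows "of_nat (n + 1) * b n = (\<Sum>i=0..n. c i * b (n - i))"
proof -
  let ?\<Phi> = "fps_expansion \<phi> 0" and ?P = "fps_expansion p 0"
  have \<Phi>: "\<phi> has_fps_expansion ?\<Phi>" and P: "p has_fps_expansion ?P"
    using has_fps_expansion_fps_expansion[OF open_ball _ \<phi>] has_fps_expansion_fps_expansion[OF open_ball _ p]
    by simp_all
  have lhs: "(\<lambda>s. \<phi> s + s * deriv \<phi> s) has_fps_expansion ?\<Phi> + fps_X * fps_deriv ?\<Phi>"
    by (intro fps_expansion_intros \<Phi>)
  have rhs: "(\<lambda>s. p s * \<phi> s) has_fps_expansion ?P * ?\<Phi>"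
    by (intro fps_expansion_intros \<Phi> P)
  have "\<forall>\<^sub>F s in nhds 0. \<phi> s + s * deriv \<phi> s = p s * \<phi> s"
  proof -
    have "\<forall>\<^sub>F s in nhds 0. s \<in> ball (0 :: complex) 1" by (intro eventually_nhds_in_open) auto
    then show ?thesis by eventually_elim (rule eq)
  qed
  from has_fps_expansion_cong[OF this refl] lhs
  have "(\<lambda>s. p s * \<phi> s) has_fps_expansion ?\<Phi> + fps_X * fps_deriv ?\<Phi>" by blast
  from fps_expansion_unique_complex[OF this rhs]
  have "fps_nth (?\<Phi> + fps_X * fps_deriv ?\<Phi>) n = fps_nth (?P * ?\<Phi>) n" by simp
  moreover have nth: "fps_nth ?\<Phi> n = b n" "fps_nth ?P n = c n" for n
    by (simp_all add: fps_expansion_def b_def c_def)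
  moreover have "fps_nth (?\<Phi> + fps_X * fps_deriv ?\<Phi>) n = of_nat (n + 1) * b n"
    by (cases n) (simp_all add: nth algebra_simps)
  ultimately show ?thesis by (simp only: fps_mult_nth)
qed

text \<open>The gap in \<open>b\<close> forces the same gap in \<open>c\<close>. In the convolution
  of index 2k the inner terms therefore vanish except i = k: for i < k because of
  \<open>c i\<close>, for i > k because of \<open>b (2 * k - i)\<close>.\<close>

lemma logderiv_coeffs_gap:
  fixes b c :: "nat \<Rightarrow> complex"
  assumes rec: "\<And>n. of_nat (n + 1) * b n = (\<Sum>i=0..n. c i * b (n - i))"
    and b0: "b 0 = 1" and c0: "c 0 = 1" and k: "0 < k"
    and gap: "\<And>n. 0 < n \<Longrightarrow> n < k \<Longrightarrow> b n = 0"
  shows "b k = c k / of_nat k" and "b (2 * k) = (c (2 * k) + (c k)\<^sup>2 / of_nat k) / of_nat (2 * k)"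
proof -
  \<comment> \<open>Moving \<open>c 0 * b n\<close> to the left turns the factor n + 1 into
    n.\<close>
  have rec': "of_nat n * b n = c n + (\<Sum>i\<in>{0<..<n}. c i * b (n - i))" if "0 < n" for n
  proof -
    have "{0..n} = insert 0 (insert n {0<..<n})" using that by auto
    then have "(\<Sum>i=0..n. c i * b (n - i)) = b n + (c n + (\<Sum>i\<in>{0<..<n}. c i * b (n - i)))"
      using that by (simp add: b0 c0)
    then show ?thesis using rec[of n] by (simp add: algebra_simps)
  qed
  have c_gap: "c n = of_nat n * b n" if "0 < n" "n \<le> k" for n
  proof -
    have "(\<Sum>i\<in>{0<..<n}. c i * b (n - i)) = 0" by (rule sum.neutral) (use that gap in auto)
    then show ?thesis using rec'[OF that(1)] by simp
  qed
  from c_gap[of k] k show bk: "b k = c k / of_nat k" by simp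
  have "(\<Sum>i\<in>{0<..<2 * k}. c i * b (2 * k - i)) = (\<Sum>i\<in>{k}. c i * b (2 * k - i))"
  proof (rule sum.mono_neutral_right)
    show "\<forall>i\<in>{0<..<2 * k} - {k}. c i * b (2 * k - i) = 0"
    proof
      fix i assume i: "i \<in> {0<..<2 * k} - {k}"
      show "c i * b (2 * k - i) = 0"
      proof (cases "i < k")
        case True
        then show ?thesis using c_gap[of i] gap[of i] i by simp
      next
        case False
        then have "b (2 * k - i) = 0" using i by (intro gap) auto
        then show ?thesis by simp
      qed
    qed
  qed (use k in auto)
  also have "\<dots> = c k * b k" by (simp add: mult_2)
  finally have "of_nat (2 * k) * b (2 * k) = c (2 * k) + c k * b k"
    using rec'[of "2 * k"] k by (simp only:)
  also have "\<dots> = c (2 * k) + (c k)\<^sup>2 / of_nat k" by (simp add: bk power2_eq_square)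
  finally have "of_nat (2 * k) * b (2 * k) = c (2 * k) + (c k)\<^sup>2 / of_nat k" .
  moreover have "of_nat (2 * k) \<noteq> (0 :: complex)" unfolding of_nat_eq_0_iff using k by simp
  ultimately show "b (2 * k) = (c (2 * k) + (c k)\<^sup>2 / of_nat k) / of_nat (2 * k)"
    by (metis nonzero_mult_div_cancel_left)
qed

text \<open>The expression equals \<open>1 - 2A\<^sup>2 - B (B - 2A\<^sup>2)\<close>, and both factors of the last term are
  affine in \<open>\<gamma>\<^sup>2\<close> and \<open>\<delta> - \<gamma>\<^sup>2\<close>.\<close>

lemma Toeplitz_determinant_bound:
  fixes \<gamma> \<delta> :: complex
  assumes \<gamma>: "norm \<gamma> \<le> 1" and \<delta>: "norm (\<delta> - \<gamma>\<^sup>2) \<le> 1 - (norm \<gamma>)\<^sup>2" and k: "1 \<le> k"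
    and A: "A = 2 * \<gamma> / of_nat k" and B: "B = (2 * \<delta> + (2 * \<gamma>)\<^sup>2 / of_nat k) / of_nat (2 * k)"
  defines "T \<equiv> cmod (1 - B\<^sup>2 - 2 * A\<^sup>2 + 2 * A\<^sup>2 * B)"
  shows "k \<le> 3 \<Longrightarrow> T \<le> 1 + 8 / real k ^ 2 + (real k + 2) * (6 - real k) / real k ^ 4"
    and "3 \<le> k \<Longrightarrow> T \<le> 1 + 8 / real k ^ 2 + (2 + real k) / real k ^ 3"
proof -
  define K where "K = real k"
  define x where "x = (norm \<gamma>)\<^sup>2"
  define w where "w = \<delta> - \<gamma>\<^sup>2"
  have K: "K \<ge> 1" using k by (simp add: K_def)
  have x: "0 \<le> x" "x \<le> 1" using \<gamma> by (auto simp: x_def power_le_one)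
  have w: "norm w \<le> 1 - x" using \<delta> by (simp add: w_def x_def)
  have kK: "(of_nat k :: complex) = of_real K" by (simp add: K_def)
  have A2: "norm (2 * A\<^sup>2) \<le> 8 / K\<^sup>2"
    using K x unfolding A kK by (simp add: norm_mult norm_divide norm_power power_mult_distrib power_divide x_def[symmetric] divide_right_mono)
  have B_eq: "B = of_real ((K + 2) / K\<^sup>2) * \<gamma>\<^sup>2 + w / of_real K"
    and BA_eq: "B - 2 * A\<^sup>2 = of_real ((K - 6) / K\<^sup>2) * \<gamma>\<^sup>2 + w / of_real K"
    using K by (simp_all add: B A kK w_def field_simps power2_eq_square)
  \<comment> \<open>Since \<open>norm w\<close> is at most 1 - x, every bound obtained this way is
    affine in \<open>x\<close> on [0, 1] and is settled at an endpoint.\<close>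
  have aff: "norm (of_real a * \<gamma>\<^sup>2 + w / of_real K) \<le> \<bar>a\<bar> * x + (1 - x) / K" for a :: real
  proof -
    have "norm (of_real a * \<gamma>\<^sup>2 + w / of_real K) \<le> norm (of_real a * \<gamma>\<^sup>2) + norm (w / of_real K)"
      by (rule norm_triangle_ineq)
    also have "\<dots> \<le> \<bar>a\<bar> * x + (1 - x) / K"
      using w K by (simp add: norm_mult norm_divide norm_power x_def divide_right_mono)
    finally show ?thesis .
  qed
  have nB: "norm B \<le> (K + 2) / K\<^sup>2"
  proof -
    have "norm B \<le> (K + 2) / K\<^sup>2 * x + (1 - x) / K" using aff[of "(K + 2) / K\<^sup>2"] K by (simp add: B_eq)
    also have "\<dots> = 1 / K + 2 / K\<^sup>2 * x" using K by (simp add: field_simps power2_eq_square)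
    also have "\<dots> \<le> 1 / K + 2 / K\<^sup>2 * 1" using x K by (intro add_left_mono mult_left_mono) auto
    also have "\<dots> = (K + 2) / K\<^sup>2" using K by (simp add: field_simps power2_eq_square)
    finally show ?thesis .
  qed
  have T: "T \<le> 1 + 8 / K\<^sup>2 + (K + 2) / K\<^sup>2 * m" if m: "norm (B - 2 * A\<^sup>2) \<le> m" for m
  proof -
    have "1 - B\<^sup>2 - 2 * A\<^sup>2 + 2 * A\<^sup>2 * B = 1 - 2 * A\<^sup>2 - B * (B - 2 * A\<^sup>2)"
      by (simp add: algebra_simps power2_eq_square)
    then have "T \<le> norm (1 - 2 * A\<^sup>2) + norm (B * (B - 2 * A\<^sup>2))"
      unfolding T_def by (simp only: norm_triangle_ineq4)
    also have "norm (1 - 2 * A\<^sup>2) \<le> 1 + 8 / K\<^sup>2"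
      using norm_triangle_ineq4[of 1 "2 * A\<^sup>2"] A2 by simp
    also have "norm (B * (B - 2 * A\<^sup>2)) \<le> (K + 2) / K\<^sup>2 * m"
      unfolding norm_mult using nB m K by (intro mult_mono) auto
    finally show ?thesis by simp
  qed
  note BA = aff[of "(K - 6) / K\<^sup>2", folded BA_eq]
  show "T \<le> 1 + 8 / real k ^ 2 + (real k + 2) * (6 - real k) / real k ^ 4" if "k \<le> 3"
  proof -
    have K3: "K \<le> 3" using that by (simp add: K_def)
    have "norm (B - 2 * A\<^sup>2) \<le> (6 - K) / K\<^sup>2 * x + (1 - x) / K"
      using BA K K3 by (simp add: abs_divide)
    also have "\<dots> = 1 / K + (6 - 2 * K) / K\<^sup>2 * x" using K by (simp add: field_simps power2_eq_square)
    \<comment> \<open>The slope 6 - 2K is nonnegative exactly up to K = 3, and then x = 1 is the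
      worst case, as it is in \<open>nB\<close>.\<close>
    also have "\<dots> \<le> 1 / K + (6 - 2 * K) / K\<^sup>2 * 1" using x K3 by (intro add_left_mono mult_left_mono) auto
    also have "\<dots> = (6 - K) / K\<^sup>2" using K by (simp add: field_simps power2_eq_square)
    finally have "T \<le> 1 + 8 / K\<^sup>2 + (K + 2) / K\<^sup>2 * ((6 - K) / K\<^sup>2)" by (rule T)
    moreover have "K ^ 4 = K\<^sup>2 * K\<^sup>2" by (simp flip: power_add)
    ultimately show ?thesis by (simp add: K_def)
  qed
  show "T \<le> 1 + 8 / real k ^ 2 + (2 + real k) / real k ^ 3" if "3 \<le> k"
  proof -
    have K3: "K \<ge> 3" using that by (simp add: K_def)
    \<comment> \<open>From K = 3 on the coefficient of \<open>x\<close> no longer exceeds 1/K, so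
      the constant 1/K, the value at x = 0, takes over.\<close>
    then have "\<bar>K - 6\<bar> / K\<^sup>2 \<le> K / K\<^sup>2" by (intro divide_right_mono) auto
    then have "\<bar>(K - 6) / K\<^sup>2\<bar> \<le> 1 / K" using K by (simp add: abs_divide power2_eq_square)
    then have "\<bar>(K - 6) / K\<^sup>2\<bar> * x \<le> 1 / K * x" using x by (intro mult_right_mono)
    with BA have "norm (B - 2 * A\<^sup>2) \<le> 1 / K * x + (1 - x) / K" by linarith
    also have "\<dots> = 1 / K" by (simp add: diff_divide_distrib)
    finally have "T \<le> 1 + 8 / K\<^sup>2 + (K + 2) / K\<^sup>2 * (1 / K)" by (rule T)
    then show ?thesis by (simp add: K_def power2_eq_square power3_eq_cube add.commute)
  qed
qed

section \<open>Support functionals\<close>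

definition sublinear :: "('a::real_vector \<Rightarrow> real) \<Rightarrow> bool"
  where "sublinear q \<longleftrightarrow> (\<forall>x y. q (x + y) \<le> q x + q y) \<and> (\<forall>r x. 0 \<le> r \<longrightarrow> q (r *\<^sub>R x) = r * q x)"

lemma sublinear_zero: "sublinear q \<Longrightarrow> q 0 = 0"
  unfolding sublinear_def by (metis mult_zero_left order_refl scaleR_zero_left)

lemma sublinear_neg: "sublinear q \<Longrightarrow> - q (- x) \<le> q x"
  using sublinear_zero[of q] unfolding sublinear_def by (metis add.right_inverse minus_le_iff add_le_same_cancel1 le_add_same_cancel1 add.commute diff_ge_0_iff_ge diff_minus_eq_add)

text \<open>Pushes a sublinear functional down in the direction \<open>y\<close>, so that it becomes linear along \<open>y\<close>.\<close>

definition lower_along :: "('a::real_vector \<Rightarrow> real) \<Rightarrow> 'a \<Rightarrow> 'a \<Rightarrow> real"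
  where "lower_along q y x = (INF t\<in>{0..}. q (x + t *\<^sub>R y) - t * q y)"

text \<open>Subadditivity bounds the family under the infimum below by \<open>- q (- x)\<close>.
  Parameters t for x and t' for x' combine to t + t' for x + x', and scaling x by r scales the
  parameter by r; this carries sublinearity over to the infimum.\<close>

lemma
  assumes q: "sublinear q"
  shows lower_along_le: "0 \<le> t \<Longrightarrow> lower_along q y x \<le> q (x + t *\<^sub>R y) - t * q y"
    and sublinear_lower_along: "sublinear (lower_along q y)"
proof -
  have add: "q (x + y) \<le> q x + q y" and scale: "0 \<le> r \<Longrightarrow> q (r *\<^sub>R x) = r * q x" for x y r
    using q by (auto simp: sublinear_def)
  let ?f = "\<lambda>x t. q (x + t *\<^sub>R y) - t * q y"
  have low: "- q (- x) \<le> ?f x t" if "0 \<le> t" for x t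
    using add[of "x + t *\<^sub>R y" "- x"] scale[OF that, of y] by simp
  have bdd: "bdd_below (?f x ` {0..})" for x
    by (rule bdd_belowI2[where m = "- q (- x)"]) (use low in auto)
  show le: "lower_along q y x \<le> ?f x t" if "0 \<le> t" for x t
    unfolding lower_along_def by (rule cINF_lower[OF bdd]) (use that in simp)
  have ge: "m \<le> lower_along q y x" if "\<And>t. 0 \<le> t \<Longrightarrow> m \<le> ?f x t" for m x
    unfolding lower_along_def by (rule cINF_greatest) (use that in auto)
  have add': "lower_along q y (x + x') \<le> lower_along q y x + lower_along q y x'" for x x'
  proof -
    have "lower_along q y (x + x') - ?f x' t' \<le> ?f x t" if "0 \<le> t" "0 \<le> t'" for t t'
    proof -
      have "lower_along q y (x + x') \<le> ?f (x + x') (t + t')" using that by (intro le) simp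
      also have "\<dots> \<le> ?f x t + ?f x' t'"
        using add[of "x + t *\<^sub>R y" "x' + t' *\<^sub>R y"] by (simp add: algebra_simps)
      finally show ?thesis by simp
    qed
    then have "lower_along q y (x + x') - ?f x' t' \<le> lower_along q y x" if "0 \<le> t'" for t'
      using that by (intro ge) blast
    then have "lower_along q y (x + x') - lower_along q y x \<le> ?f x' t'" if "0 \<le> t'" for t'
      using that by (simp add: algebra_simps)
    then have "lower_along q y (x + x') - lower_along q y x \<le> lower_along q y x'" by (rule ge)
    then show ?thesis by simp
  qed
  have scale_le: "lower_along q y (r *\<^sub>R x) \<le> r * lower_along q y x" if r: "0 < r" for r x
  proof -
    have "lower_along q y (r *\<^sub>R x) / r \<le> ?f x t" if t: "0 \<le> t" for t
    proof -
      have "lower_along q y (r *\<^sub>R x) \<le> ?f (r *\<^sub>R x) (r * t)" using r t by (intro le) simp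
      also have "\<dots> = r * ?f x t"
        using scale[of r "x + t *\<^sub>R y"] r by (simp add: algebra_simps)
      finally show ?thesis using r by (simp add: divide_le_eq mult.commute)
    qed
    then have "lower_along q y (r *\<^sub>R x) / r \<le> lower_along q y x" by (rule ge)
    then show ?thesis using r by (simp add: divide_le_eq mult.commute)
  qed
  have scale': "lower_along q y (r *\<^sub>R x) = r * lower_along q y x" if "0 \<le> r" for r x
  proof (cases "r = 0")
    case True
    have "lower_along q y 0 = 0"
    proof (rule antisym)
      show "lower_along q y 0 \<le> 0" using le[of 0 0] sublinear_zero[OF q] by simp
      show "0 \<le> lower_along q y 0" by (rule ge) (simp add: scale)
    qed
    then show ?thesis using True by simp
  next
    case False
    then have r: "0 < r" using that by simp
    \<comment> \<open>The reverse inequality is \<open>scale_le\<close> for the factor 1/r at the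
      point r x.\<close>
    have "r * lower_along q y ((1 / r) *\<^sub>R r *\<^sub>R x) \<le> r * (1 / r * lower_along q y (r *\<^sub>R x))"
      using r by (intro mult_left_mono scale_le) auto
    then show ?thesis using scale_le[OF r, of x] r by simp
  qed
  from add' scale' show "sublinear (lower_along q y)" by (simp add: sublinear_def)
qed

text \<open>By minimality \<open>lower_along q y\<close> is \<open>q\<close> itself, and its bound
  at t = 1 reads q x \<le> q (x + y) - q y, the missing half of additivity.\<close>

lemma linear_if_minimal_sublinear:
  assumes q: "sublinear q" and min: "\<And>q'. sublinear q' \<Longrightarrow> (\<And>x. q' x \<le> q x) \<Longrightarrow> q' = q"
  shows "linear q"
proof -
  have "q x + q y = q (x + y)" for x y
  proof (rule antisym)
    have "lower_along q y = q"
      by (rule min[OF sublinear_lower_along[OF q]]) (use lower_along_le[OF q, of 0 y] in simp)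
    then show "q x + q y \<le> q (x + y)" using lower_along_le[OF q, of 1 y x] by simp
  qed (use q in \<open>simp add: sublinear_def\<close>)
  note add = this
  have neg: "q (- x) = - q x" for x using add[of x "- x"] sublinear_zero[OF q] by simp
  show ?thesis
  proof
    show "q (r *\<^sub>R x) = r *\<^sub>R q x" for r x
    proof (cases "0 \<le> r")
      case True
      then show ?thesis using q by (simp add: sublinear_def)
    next
      case False
      then have "q ((- r) *\<^sub>R x) = - r * q x" using q by (simp only: sublinear_def)
      then show ?thesis using neg[of "r *\<^sub>R x"] by simp
    qed
  qed (simp add: add)
qed

text \<open>Zorn's lemma is applied to sublinear functionals on the whole space rather than to
  extensions from subspaces. All of them below \<open>p\<close> share the lower bound
  \<open>- p (- x)\<close>, so pointwise infima over chains are finite.\<close>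

lemma ex_linear_below_sublinear:
  assumes p: "sublinear p"
  shows "\<exists>q. linear q \<and> (\<forall>x. q x \<le> p x)"
proof -
  define A where "A = {q. sublinear q \<and> q \<le> p}"
  \<comment> \<open>The order is reversed: a maximal element for \<open>P\<close> is a minimal
    sublinear functional.\<close>
  define P where "P q q' \<longleftrightarrow> q' \<le> q" for q q' :: "'a \<Rightarrow> real"
  have low: "- p (- x) \<le> q x" if "q \<in> A" for q x
  proof -
    have "- p (- x) \<le> - q (- x)" using that by (simp add: A_def le_fun_def)
    also have "\<dots> \<le> q x" using that sublinear_neg by (auto simp: A_def)
    finally show ?thesis .
  qed
  have "\<exists>q \<in> A. \<forall>a \<in> A. P q a \<longrightarrow> a = q"
  proof (rule predicate_Zorn)
    show "partial_order_on A (relation_of P A)"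
      by (auto simp: partial_order_on_def preorder_on_def refl_on_def trans_def antisym_def relation_of_def P_def)
    fix C assume C: "C \<in> Chains (relation_of P A)"
    show "\<exists>u\<in>A. \<forall>a\<in>C. P a u"
    proof (cases "C = {}")
      case True
      then show ?thesis using p by (auto simp: A_def)
    next
      case False
      have CA: "C \<subseteq> A" using C by (auto simp: Chains_def relation_of_def)
      have chain: "a \<le> b \<or> b \<le> a" if "a \<in> C" "b \<in> C" for a b
        using C that by (auto simp: Chains_def relation_of_def P_def)
      define u where "u x = (INF q\<in>C. q x)" for x
      have bdd: "bdd_below ((\<lambda>q. q x) ` C)" for x
        by (rule bdd_belowI2[where m = "- p (- x)"]) (use low CA in blast)
      have le: "u x \<le> q x" if "q \<in> C" for q x
        unfolding u_def by (rule cINF_lower[OF bdd that])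
      have ge: "m \<le> u x" if "\<And>q. q \<in> C \<Longrightarrow> m \<le> q x" for m x
        unfolding u_def by (rule cINF_greatest[OF False that])
      have sub: "q (x + y) \<le> q x + q y" "0 \<le> r \<Longrightarrow> q (r *\<^sub>R x) = r * q x" if "q \<in> C" for q x y r
        using that CA by (auto simp: A_def sublinear_def)
      have "u (x + y) \<le> u x + u y" for x y
      proof -
        \<comment> \<open>Here the chain condition enters: the smaller of \<open>q\<close> and
          \<open>q'\<close> can be used at both points.\<close>
        have "u (x + y) \<le> q x + q' y" if "q \<in> C" "q' \<in> C" for q q'
          using chain[OF that]
        proof
          assume "q \<le> q'"
          then show ?thesis using le[OF that(1), of "x + y"] sub(1)[OF that(1), of x y] le_funD[of q q' y] by simp
        next
          assume "q' \<le> q"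
          then show ?thesis using le[OF that(2), of "x + y"] sub(1)[OF that(2), of x y] le_funD[of q' q x] by simp
        qed
        then have "u (x + y) - q' y \<le> u x" if "q' \<in> C" for q'
          using that by (intro ge) (simp add: algebra_simps)
        then have "u (x + y) - u x \<le> u y" by (intro ge) (simp add: algebra_simps)
        then show ?thesis by simp
      qed
      moreover have "u (r *\<^sub>R x) = r * u x" if r: "0 \<le> r" for r x
      proof -
        have "(\<lambda>q. q (r *\<^sub>R x)) ` C = (\<lambda>q. r * q x) ` C" using sub(2) r by (intro image_cong) auto
        moreover have "(INF q\<in>C. r * q x) = r * (INF q\<in>C. q x)"
        proof (rule antisym)
          have bdd': "bdd_below ((\<lambda>q. r * q x) ` C)"
            by (rule bdd_belowI2[where m = "r * u x"]) (use le r in \<open>auto intro: mult_left_mono\<close>)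
          show "(INF q\<in>C. r * q x) \<le> r * (INF q\<in>C. q x)"
          proof (cases "r = 0")
            case True
            then show ?thesis using False by simp
          next
            case False
            with r have r': "0 < r" by simp
            have "(INF q\<in>C. r * q x) / r \<le> u x"
            proof (rule ge)
              show "(INF q\<in>C. r * q x) / r \<le> q x" if "q \<in> C" for q
                using cINF_lower[OF bdd' that] r' by (simp add: divide_le_eq mult.commute)
            qed
            then show ?thesis using r' by (simp add: divide_le_eq mult.commute u_def)
          qed
          show "r * (INF q\<in>C. q x) \<le> (INF q\<in>C. r * q x)"
            by (rule cINF_greatest[OF False]) (use le r in \<open>auto intro: mult_left_mono simp: u_def[symmetric]\<close>)
        qed
        ultimately show ?thesis by (simp add: u_def)
      qed
      ultimately have "sublinear u" by (simp add: sublinear_def)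
      moreover have "u \<le> p"
      proof (rule le_funI)
        fix x
        obtain q where "q \<in> C" using False by blast
        moreover from this have "q x \<le> p x" using CA by (auto simp: A_def le_fun_def)
        ultimately show "u x \<le> p x" using le by (meson order_trans)
      qed
      ultimately have "u \<in> A" by (simp add: A_def)
      with le show ?thesis by (auto simp: P_def le_fun_def)
    qed
  qed
  then obtain q where q: "q \<in> A" and min: "\<And>a. a \<in> A \<Longrightarrow> a \<le> q \<Longrightarrow> a = q"
    by (auto simp: P_def)
  have "linear q"
  proof (rule linear_if_minimal_sublinear)
    show "sublinear q" using q by (simp add: A_def)
    fix q' assume q': "sublinear q'" "\<And>x. q' x \<le> q x"
    then have "q' \<le> q" by (simp add: le_fun_def)
    moreover from this have "q' \<in> A" using q q'(1) by (auto simp: A_def)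
    ultimately show "q' = q" using min by blast
  qed
  then show ?thesis using q by (auto simp: A_def le_fun_def)
qed

text \<open>The value at the nonzero \<open>u\<close> already forces the norm up to 1, so a
  pointwise upper bound is all that remains.\<close>

lemma support_functionalsI:
  assumes "u \<noteq> 0" "bounded_clinear l" "l u = of_real (norm u)" "\<And>x. norm (l x) \<le> norm x"
  shows "l \<in> support_functionals u"
proof -
  have "onorm l = 1"
  proof (rule antisym)
    show "onorm l \<le> 1" by (rule onorm_bound) (use assms(4) in auto)
    have "norm u \<le> onorm l * norm u"
      using onorm[OF bounded_clinear_imp_bounded_linear[OF assms(2)], of u] assms(3) by simp
    then show "1 \<le> onorm l" using assms(1) by simp
  qed
  with assms show ?thesis by (simp add: support_functionals_def)
qed

lemma support_functionalsD:
  assumes "l \<in> support_functionals u"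
  shows "bounded_clinear l" "l u = of_real (norm u)" "norm (l x) \<le> norm x"
proof -
  from assms show l: "bounded_clinear l" "l u = of_real (norm u)"
    by (simp_all add: support_functionals_def)
  show "norm (l x) \<le> norm x"
    using onorm[OF bounded_clinear_imp_bounded_linear[OF l(1)], of x] assms
    by (simp add: support_functionals_def)
qed

text \<open>Looking below \<open>lower_along norm u\<close> instead of \<open>norm\<close>
  prescribes the value at \<open>u\<close>: its parameter t = 1 gives
  \<open>\<phi> (- u) \<le> - norm u\<close>. The complex functional is then \<phi>(x) - i
  \<phi>(ix).\<close>

lemma ex_support_functional:
  fixes u :: "'a::complex_banach"
  assumes u: "u \<noteq> 0"
  shows "\<exists>l. l \<in> support_functionals u"
proof -
  have norm_sub: "sublinear (norm :: 'a \<Rightarrow> real)" by (simp add: sublinear_def norm_triangle_ineq)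
  obtain \<phi> where lin: "linear \<phi>" and le: "\<And>x. \<phi> x \<le> lower_along norm u x"
    using ex_linear_below_sublinear[OF sublinear_lower_along[OF norm_sub]] by blast
  have le_norm: "\<phi> x \<le> norm x" for x
    using le[of x] lower_along_le[OF norm_sub, of 0 u x] by simp
  have "\<phi> (- u) \<le> - norm u"
    using le[of "- u"] lower_along_le[OF norm_sub, of 1 u "- u"] by simp
  then have \<phi>u: "\<phi> u = norm u"
    using linear_neg[OF lin, of u] le_norm[of u] by simp
  define l where "l x = Complex (\<phi> x) (- \<phi> (\<i> *\<^sub>C x))" for x
  have ii: "\<i> *\<^sub>C \<i> *\<^sub>C x = - x" for x :: 'a
  proof -
    have "\<i> *\<^sub>C \<i> *\<^sub>C x = complex_of_real (- 1) *\<^sub>C x" by (simp add: scaleC_scaleC)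
    also have "\<dots> = - x" unfolding scaleC_of_real by simp
    finally show ?thesis .
  qed
  have l_add: "l (x + y) = l x + l y" for x y
    by (simp add: l_def complex_eq_iff linear_add[OF lin] scaleC_add_right)
  have l_real: "l (complex_of_real r *\<^sub>C x) = of_real r * l x" for r x
  proof -
    have "\<i> *\<^sub>C complex_of_real r *\<^sub>C x = r *\<^sub>R \<i> *\<^sub>C x"
      by (simp add: scaleC_scaleC mult.commute flip: scaleC_of_real)
    then show ?thesis
      by (simp add: l_def complex_eq_iff linear_scale[OF lin] scaleC_of_real)
  qed
  have l_i: "l (\<i> *\<^sub>C x) = \<i> * l x" for x
    by (simp add: l_def complex_eq_iff ii linear_neg[OF lin])
  have l_scale: "l (c *\<^sub>C x) = c * l x" for c x
  proof -
    have "c *\<^sub>C x = complex_of_real (Re c) *\<^sub>C x + \<i> *\<^sub>C complex_of_real (Im c) *\<^sub>C x"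
      using complex_eq[of c] by (simp add: scaleC_scaleC flip: scaleC_add_left)
    then have "l (c *\<^sub>C x) = of_real (Re c) * l x + \<i> * (of_real (Im c) * l x)"
      by (simp only: l_add l_real l_i)
    also have "\<dots> = (of_real (Re c) + \<i> * of_real (Im c)) * l x" by (simp add: algebra_simps)
    finally show ?thesis by (simp only: complex_eq[symmetric])
  qed
  have l_norm: "norm (l x) \<le> norm x" for x
  proof (cases "l x = 0")
    case False
    \<comment> \<open>A rotation making \<open>l (c *\<^sub>C x)\<close> real, hence equal to its
      real part \<open>\<phi>\<close>, which the norm dominates.\<close>
    define c where "c = cnj (l x) / of_real (norm (l x))"
    have "l (c *\<^sub>C x) = of_real (norm (l x))"
      using False by (simp add: l_scale c_def complex_norm_square[symmetric] power2_eq_square mult.commute[of "cnj _"])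
    then have "norm (l x) = \<phi> (c *\<^sub>C x)" by (simp add: l_def complex_eq_iff)
    also have "\<dots> \<le> norm (c *\<^sub>C x)" by (rule le_norm)
    also have "\<dots> = norm x" using False by (simp add: norm_scaleC c_def norm_divide)
    finally show ?thesis .
  qed simp
  have bl: "bounded_linear l"
  proof (rule bounded_linear_intro[where K = 1])
    show "l (r *\<^sub>R x) = r *\<^sub>R l x" for r x
      using l_real[of r x] by (simp add: scaleC_of_real scaleR_conv_of_real)
  qed (use l_add l_norm in auto)
  have lu: "l u = of_real (norm u)"
  proof -
    \<comment> \<open>The real part of \<open>l u\<close> already exhausts the bound on its modulus,
      leaving no room for an imaginary part.\<close>
    have "(norm u)\<^sup>2 + (Im (l u))\<^sup>2 \<le> (norm u)\<^sup>2"
      using power_mono[OF l_norm[of u], of 2] by (simp add: cmod_power2 l_def \<phi>u)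
    then have "Im (l u) = 0" by simp
    then show ?thesis by (simp add: complex_eq_iff l_def \<phi>u)
  qed
  have "bounded_clinear l" using bl l_scale by (simp add: bounded_clinear_def scaleC_complex_def)
  then show ?thesis using support_functionalsI[OF u _ lu l_norm] by blast
qed

section \<open>Reduction to one variable\<close>

lemma open_line_preimage:
  fixes x v :: "'a::complex_banach"
  assumes "open S"
  shows "open {s. x + s *\<^sub>C v \<in> S}"
proof -
  have "continuous_on UNIV (\<lambda>s. x + s *\<^sub>C v)"
    by (intro continuous_intros bounded_linear.continuous_on[OF bounded_bilinear.bounded_linear_left[OF bounded_bilinear_scaleC]])
  from open_vimage[OF assms this] show ?thesis by (simp add: vimage_def)
qed

text \<open>It guarantees that every \<open>frechet_derivative\<close> unfolded from
  \<open>nth_frechet_derivative\<close> is a genuine derivative on \<open>S\<close>.\<close>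

lemma holomorphic_map_on_nth_frechet_derivative:
  fixes f :: "'a::complex_banach \<Rightarrow> complex"
  assumes "holomorphic_map_on f S" "open S"
  shows "holomorphic_map_on (\<lambda>y. nth_frechet_derivative m f y v) S"
  by (induction m) (simp_all add: assms holomorphic_map_on_frechet_derivative)

lemma higher_deriv_along_line:
  fixes f :: "'a::complex_banach \<Rightarrow> complex"
  assumes f: "holomorphic_map_on f S" and S: "open S" and s: "x + s *\<^sub>C v \<in> S"
  shows "(deriv ^^ m) (\<lambda>s. f (x + s *\<^sub>C v)) s = nth_frechet_derivative m f (x + s *\<^sub>C v) (\<lambda>_. v)"
  using s
proof (induction m arbitrary: s)
  case (Suc m)
  let ?h = "\<lambda>s. nth_frechet_derivative m f (x + s *\<^sub>C v) (\<lambda>_. v)"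
  have "\<forall>\<^sub>F t in nhds s. t \<in> {s. x + s *\<^sub>C v \<in> S}"
    using Suc.prems by (intro eventually_nhds_in_open open_line_preimage S) auto
  then have "\<forall>\<^sub>F t in nhds s. (deriv ^^ m) (\<lambda>s. f (x + s *\<^sub>C v)) t = ?h t"
    by eventually_elim (simp add: Suc.IH)
  then have "(deriv ^^ Suc m) (\<lambda>s. f (x + s *\<^sub>C v)) s = deriv ?h s"
    by (simp add: deriv_cong_ev)
  also have "\<dots> = nth_frechet_derivative (Suc m) f (x + s *\<^sub>C v) (\<lambda>_. v)"
    using has_field_derivative_along_line[OF holomorphic_map_on_nth_frechet_derivative[OF f S] Suc.prems]
    by (simp add: DERIV_imp_deriv)
  finally show ?case .
qed simp

lemma has_derivative_mult_id:
  fixes f :: "'a::complex_banach \<Rightarrow> complex"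
  assumes "(f has_derivative f') (at y)"
  shows "((\<lambda>z. f z *\<^sub>C z) has_derivative (\<lambda>h. f y *\<^sub>C h + f' h *\<^sub>C y)) (at y)"
  by (rule scaleC_has_derivative[OF assms has_derivative_ident])

text \<open>Leibniz' rule stops after two terms because the identity map has no second derivative.
  For m = 0 the truncated index m - 1 is neutralised by the factor \<open>of_nat m\<close>. At y = 0
  only a multiple of \<open>v\<close> is left.\<close>

lemma nth_frechet_derivative_mult_id:
  fixes f :: "'a::complex_banach \<Rightarrow> complex"
  assumes f: "holomorphic_map_on f S" and S: "open S" and y: "y \<in> S"
  shows "nth_frechet_derivative m (\<lambda>z. f z *\<^sub>C z) y (\<lambda>_. v) =
    nth_frechet_derivative m f y (\<lambda>_. v) *\<^sub>C y
      + (of_nat m * nth_frechet_derivative (m - 1) f y (\<lambda>_. v)) *\<^sub>C v"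
  using y
proof (induction m arbitrary: y)
  case (Suc m)
  let ?D = "\<lambda>j y. nth_frechet_derivative j f y (\<lambda>_. v)"
  let ?D' = "\<lambda>j. frechet_derivative (?D j) (at y)"
  note der = holomorphic_map_on_derivative(1)[OF holomorphic_map_on_nth_frechet_derivative[OF f S] Suc.prems]
  have "((\<lambda>y. ?D m y *\<^sub>C y + (of_nat m * ?D (m - 1) y) *\<^sub>C v) has_derivative
      (\<lambda>h. (?D m y *\<^sub>C h + ?D' m h *\<^sub>C y) + (of_nat m * ?D' (m - 1) h) *\<^sub>C v)) (at y)"
    by (intro has_derivative_add has_derivative_mult_id has_derivative_mult_right der
        bounded_linear.has_derivative[OF bounded_bilinear.bounded_linear_left[OF bounded_bilinear_scaleC]])
  then have "((\<lambda>y. nth_frechet_derivative m (\<lambda>z. f z *\<^sub>C z) y (\<lambda>_. v)) has_derivative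
      (\<lambda>h. (?D m y *\<^sub>C h + ?D' m h *\<^sub>C y) + (of_nat m * ?D' (m - 1) h) *\<^sub>C v)) (at y)"
    by (rule has_derivative_transform_within_open[OF _ S Suc.prems]) (simp only: Suc.IH)
  from frechet_derivative_at[OF this]
  have "nth_frechet_derivative (Suc m) (\<lambda>z. f z *\<^sub>C z) y (\<lambda>_. v) =
      (?D m y *\<^sub>C v + ?D (Suc m) y *\<^sub>C y) + (of_nat m * ?D' (m - 1) v) *\<^sub>C v"
    by (simp add: fun_eq_iff)
  also have "of_nat m * ?D' (m - 1) v = of_nat m * ?D m y" by (cases m) simp_all
  also have "(?D m y *\<^sub>C v + ?D (Suc m) y *\<^sub>C y) + (of_nat m * ?D m y) *\<^sub>C v =
      ?D (Suc m) y *\<^sub>C y + (of_nat (Suc m) * ?D m y) *\<^sub>C v"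
    by (simp add: algebra_simps scaleC_add_left)
  finally show ?case by simp
qed simp

text \<open>The derivative of F is a multiple of z, so \<open>l\<close> contributes only
  \<open>norm z\<close>, all powers of \<open>norm z\<close> cancel, and the factor m + 1 of the
  product rule reduces (m + 1)! to m!.\<close>

lemma taylor_coeff_mult_id:
  fixes f :: "'a::complex_banach \<Rightarrow> complex"
  assumes f: "holomorphic_map_on f (ball 0 1)" and z: "z \<in> ball 0 1 - {0}" and l: "l \<in> support_functionals z"
    and u: "u = complex_of_real (1 / norm z) *\<^sub>C z"
  shows "taylor_coeff (\<lambda>z. f z *\<^sub>C z) z l (Suc m) = (deriv ^^ m) (\<lambda>s. f (s *\<^sub>C u)) 0 / fact m"
proof -
  have r: "0 < norm z" "norm z < 1" using z by auto
  have zu: "z = complex_of_real (norm z) *\<^sub>C u" using r by (simp add: u scaleC_scaleC flip: of_real_mult)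
  have nu: "norm u = 1" using r by (simp add: u norm_scaleC norm_divide)
  have hol: "(\<lambda>s. f (s *\<^sub>C u)) holomorphic_on ball 0 1"
    using holomorphic_along_line[OF f, of "ball 0 1" 0 u] by (simp add: norm_scaleC nu)
  have "nth_frechet_derivative m f 0 (\<lambda>_. z) = (deriv ^^ m) (\<lambda>s. f (0 + s *\<^sub>C z)) 0"
    using higher_deriv_along_line[OF f open_ball, of 0 0 z m] by simp
  also have "(\<lambda>s. f (0 + s *\<^sub>C z)) = (\<lambda>s. f ((complex_of_real (norm z) * s) *\<^sub>C u))"
    by (subst zu) (simp add: scaleC_scaleC mult.commute)
  also have "(deriv ^^ m) \<dots> 0 = of_real (norm z) ^ m * (deriv ^^ m) (\<lambda>s. f (s *\<^sub>C u)) (of_real (norm z) * 0)"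
  proof (rule higher_deriv_compose_linear[OF hol open_ball open_ball])
    show "of_real (norm z) * w \<in> ball 0 1" if "w \<in> ball 0 1" for w :: complex
      using that r mult_strict_mono[of "norm z" 1 "norm w" 1] by (simp add: norm_mult)
  qed simp
  finally have D: "nth_frechet_derivative m f 0 (\<lambda>_. z) = of_real (norm z) ^ m * (deriv ^^ m) (\<lambda>s. f (s *\<^sub>C u)) 0"
    by simp
  have lin: "l (c *\<^sub>C z) = c * of_real (norm z)" for c
    using bounded_clinear_scaleC[OF support_functionalsD(1)[OF l], of c z] support_functionalsD(2)[OF l]
    by (simp add: scaleC_complex_def)
  have "nth_frechet_derivative (Suc m) (\<lambda>z. f z *\<^sub>C z) 0 (\<lambda>_. z) =
      (of_nat (Suc m) * nth_frechet_derivative m f 0 (\<lambda>_. z)) *\<^sub>C z"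
    using nth_frechet_derivative_mult_id[OF f open_ball, of 0 "Suc m" z]
    by (simp del: nth_frechet_derivative.simps)
  then show ?thesis
    using r by (simp add: taylor_coeff_def lin D field_simps del: nth_frechet_derivative.simps of_nat_Suc)
qed

text \<open>The derivative of F at su multiplies the line of \<open>u\<close> by g = (s \<phi>)',
  nonzero by injectivity, so the inverse derivative takes F(su) to (s \<phi> / g) u. Positivity of
  Re (\<phi> / g) excludes zeros of \<phi> and passes to the reciprocal g / \<phi> = 1 + s \<phi>' /
  \<phi>.\<close>

lemma starlike_along_line:
  fixes f :: "'a::complex_banach \<Rightarrow> complex"
  assumes f: "holomorphic_map_on f (ball 0 1)" and F: "starlike_mapping (\<lambda>z. f z *\<^sub>C z)"
    and u: "norm u = 1" and l: "l \<in> support_functionals u" and s: "s \<in> ball 0 1" "s \<noteq> 0"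
  defines "\<phi> \<equiv> (\<lambda>s. f (s *\<^sub>C u))"
  shows "\<phi> s \<noteq> 0" and "0 < Re (1 + s * deriv \<phi> s / \<phi> s)"
proof -
  define x where "x = s *\<^sub>C u"
  define D where "D = frechet_derivative (\<lambda>z. f z *\<^sub>C z) (at x)"
  define g where "g = \<phi> s + s * deriv \<phi> s"
  have x: "x \<in> ball 0 1" "x \<noteq> 0" "norm x = norm s" using s u by (auto simp: x_def norm_scaleC)
  have D_eq: "D = (\<lambda>h. f x *\<^sub>C h + frechet_derivative f (at x) h *\<^sub>C x)"
    unfolding D_def
    by (rule frechet_derivative_at[OF has_derivative_mult_id[OF holomorphic_map_on_derivative(1)[OF f x(1)]], symmetric])
  have "((\<lambda>s. f (0 + s *\<^sub>C u)) has_field_derivative frechet_derivative f (at (0 + s *\<^sub>C u)) u) (at s)"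
    by (rule has_field_derivative_along_line[OF f]) (use x in \<open>simp add: x_def\<close>)
  then have "deriv \<phi> s = frechet_derivative f (at x) u"
    by (simp add: DERIV_imp_deriv \<phi>_def x_def)
  then have D_u: "D (c *\<^sub>C u) = (c * g) *\<^sub>C u" for c
    using bounded_clinear_scaleC[OF holomorphic_map_on_derivative(2)[OF f x(1)], of c u]
    by (simp add: D_eq g_def \<phi>_def x_def scaleC_scaleC scaleC_complex_def algebra_simps flip: scaleC_add_left)
  have bij: "bij D"
    using F x(1) by (auto simp: starlike_mapping_def locally_biholomorphic_on_def has_bounded_inverse_def D_def)
  have "g \<noteq> 0"
  proof
    assume "g = 0"
    then have "D (1 *\<^sub>C u) = D (0 *\<^sub>C u)" unfolding D_u by simp
    then have "1 *\<^sub>C u = 0 *\<^sub>C u" using bij by (meson bij_is_inj injD)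
    then show False using u by simp
  qed
  then have "D ((s * \<phi> s / g) *\<^sub>C u) = f x *\<^sub>C x"
    by (simp add: D_u \<phi>_def x_def scaleC_scaleC mult.commute)
  then have inv: "inv D (f x *\<^sub>C x) = (s * \<phi> s / g) *\<^sub>C u"
    by (metis bij bij_is_inj inv_f_f)
  \<comment> \<open>Rotating \<open>l\<close> by the conjugate phase of \<open>s\<close> turns a
    support functional of \<open>u\<close> into one of \<open>s *\<^sub>C u\<close>.\<close>
  define l' where "l' h = cnj s / of_real (norm s) * l h" for h
  have lu: "l u = 1" using support_functionalsD(2)[OF l] u by simp
  note l_scale = bounded_clinear_scaleC[OF support_functionalsD(1)[OF l], unfolded scaleC_complex_def]
  have "l' \<in> support_functionals x"
  proof (rule support_functionalsI[OF x(2)])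
    show "bounded_clinear l'"
      unfolding bounded_clinear_def l'_def
      using bounded_linear_const_mult[OF bounded_clinear_imp_bounded_linear[OF support_functionalsD(1)[OF l]],
          of "cnj s / of_real (norm s)"]
      by (simp add: l_scale scaleC_complex_def)
    show "l' x = of_real (norm x)"
      using s by (simp add: l'_def norm_scaleC u x_def l_scale lu complex_norm_square[symmetric] power2_eq_square mult.commute[of "cnj s"])
    show "norm (l' h) \<le> norm h" for h
      using support_functionalsD(3)[OF l, of h] s by (simp add: l'_def norm_mult norm_divide)
  qed
  then have "0 < Re (l' (inv D (f x *\<^sub>C x)))"
    using F x by (auto simp: starlike_mapping_def D_def)
  also have "l' (inv D (f x *\<^sub>C x)) = of_real (norm s) * (\<phi> s / g)"
  proof -
    have "l' (inv D (f x *\<^sub>C x)) = (s * cnj s) / of_real (norm s) * (\<phi> s / g)"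
      by (simp add: l'_def inv l_scale lu)
    also have "(s * cnj s) / of_real (norm s) = of_real (norm s)"
      using s by (simp add: complex_norm_square[symmetric] power2_eq_square)
    finally show ?thesis .
  qed
  also have "Re (of_real (norm s) * w) = norm s * Re w" for w by simp
  finally have pos: "0 < Re (\<phi> s / g)" using s by (simp only: zero_less_mult_iff) simp
  then show nz: "\<phi> s \<noteq> 0" by auto
  have "1 + s * deriv \<phi> s / \<phi> s = inverse (\<phi> s / g)"
    using nz \<open>g \<noteq> 0\<close> by (simp add: g_def field_simps)
  moreover have "0 < Re (inverse w)" if "0 < Re w" for w :: complex
    using that by (simp add: divide_pos_pos add_pos_nonneg)
  ultimately show "0 < Re (1 + s * deriv \<phi> s / \<phi> s)" using pos by metis
qed

lemma Toeplitz_determinant_starlike: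
  fixes f :: "'a::complex_banach \<Rightarrow> complex"
  assumes k: "1 \<le> k" and f: "holomorphic_map_on f (ball 0 1)" and F: "starlike_mapping (\<lambda>z. f z *\<^sub>C z)"
    and ord: "zero_of_order (k + 1) (\<lambda>z. f z *\<^sub>C z - z)"
    and z: "z \<in> ball 0 1 - {0}" and l: "l \<in> support_functionals z"
  defines "a \<equiv> taylor_coeff (\<lambda>z. f z *\<^sub>C z) z l"
  defines "T \<equiv> cmod (1 - (a (2*k+1))^2 - 2 * (a (k+1))^2 + 2 * (a (k+1))^2 * a (2*k+1))"
  shows "k \<le> 3 \<Longrightarrow> T \<le> 1 + 8 / real k ^ 2 + (real k + 2) * (6 - real k) / real k ^ 4"
    and "3 \<le> k \<Longrightarrow> T \<le> 1 + 8 / real k ^ 2 + (2 + real k) / real k ^ 3"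
proof -
  define u where "u = complex_of_real (1 / norm z) *\<^sub>C z"
  define \<phi> where "\<phi> = (\<lambda>s. f (s *\<^sub>C u))"
  define b where "b n = (deriv ^^ n) \<phi> 0 / fact n" for n
  have nu: "norm u = 1" using z by (simp add: u_def norm_scaleC norm_divide)
  then have u0: "u \<noteq> 0" by auto
  have a: "a (Suc m) = b m" for m
    unfolding a_def b_def \<phi>_def by (rule taylor_coeff_mult_id[OF f z l u_def])
  obtain l' where l': "l' \<in> support_functionals u" using ex_support_functional[OF u0] by blast
  note star = starlike_along_line[OF f F nu l']
  have hol: "\<phi> holomorphic_on ball 0 1"
    using holomorphic_along_line[OF f, of "ball 0 1" 0 u] by (simp add: norm_scaleC nu \<phi>_def)
  \<comment> \<open>The normalisation DF(0) = I, applied to \<open>u\<close>, reads f(0) u =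
    u.\<close>
  have b0: "b 0 = 1"
  proof -
    have "u = frechet_derivative (\<lambda>z. f z *\<^sub>C z) (at 0) u"
      using F by (simp add: starlike_mapping_def normalized_map_def)
    also have "\<dots> = f 0 *\<^sub>C u"
      using nth_frechet_derivative_mult_id[OF f open_ball, of 0 1 u] by simp
    finally have "(f 0 - 1) *\<^sub>C u = 0" by (simp add: scaleC_diff_left)
    then show ?thesis using u0 by (simp add: b_def \<phi>_def)
  qed
  then have \<phi>0: "\<phi> 0 = 1" by (simp add: b_def)
  have nz: "\<phi> s \<noteq> 0" if "s \<in> ball 0 1" for s
    using star(1)[OF that] \<phi>0 by (cases "s = 0") (auto simp: \<phi>_def)
  define p where "p s = 1 + s * deriv \<phi> s / \<phi> s" for s
  have p_hol: "p holomorphic_on ball 0 1"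
    unfolding p_def by (intro holomorphic_intros hol nz) auto
  have p_pos: "0 < Re (p s)" if "s \<in> ball 0 1" for s
    using star(2)[OF that] by (cases "s = 0") (auto simp: p_def \<phi>_def)
  define c where "c n = (deriv ^^ n) p 0 / fact n" for n
  have rec: "of_nat (n + 1) * b n = (\<Sum>i=0..n. c i * b (n - i))" for n
    unfolding b_def c_def by (rule logderiv_coeff_recurrence[OF hol p_hol]) (simp add: p_def nz field_simps)
  \<comment> \<open>F - id has the same form with f - 1 in place of f. Its derivative of order n + 1
    in direction \<open>u\<close> carries \<open>b n\<close>, so a zero of order k + 1 clears the
    indices below k.\<close>
  have gap: "b n = 0" if n: "0 < n" "n < k" for n
  proof -
    let ?f = "\<lambda>z. f z - 1"
    have f1: "holomorphic_map_on ?f (ball 0 1)"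
    proof (rule holomorphic_map_onI[OF _ holomorphic_map_on_derivative(2)[OF f]])
      show "(?f has_derivative frechet_derivative f (at w)) (at w)" if "w \<in> ball 0 1" for w
        using has_derivative_diff[OF holomorphic_map_on_derivative(1)[OF f that] has_derivative_const[of 1]]
        by simp
    qed
    have eq: "(\<lambda>z. f z *\<^sub>C z - z) = (\<lambda>z. ?f z *\<^sub>C z)" by (simp add: scaleC_diff_left)
    have "\<forall>j. 1 \<le> j \<and> j < k + 1 \<longrightarrow> (\<forall>v. nth_frechet_derivative j (\<lambda>z. ?f z *\<^sub>C z) 0 v = 0)"
      using ord unfolding zero_of_order_def eq by blast
    then have "nth_frechet_derivative (Suc n) (\<lambda>z. ?f z *\<^sub>C z) 0 (\<lambda>_. u) = 0"
      using n by (simp del: nth_frechet_derivative.simps)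
    then have "(of_nat (Suc n) * nth_frechet_derivative n ?f 0 (\<lambda>_. u)) *\<^sub>C u = 0"
      using nth_frechet_derivative_mult_id[OF f1 open_ball, of 0 "Suc n" u]
      by (simp del: nth_frechet_derivative.simps)
    then have "nth_frechet_derivative n ?f 0 (\<lambda>_. u) = 0"
      using u0 by (simp del: of_nat_Suc)
    then have "(deriv ^^ n) (\<lambda>s. \<phi> s - 1) 0 = 0"
      using higher_deriv_along_line[OF f1 open_ball, of 0 0 u n] by (simp add: \<phi>_def)
    moreover have "(deriv ^^ n) (\<lambda>s. \<phi> s - 1) 0 = (deriv ^^ n) \<phi> 0 - (deriv ^^ n) (\<lambda>_. 1) 0"
      by (rule higher_deriv_diff[OF hol _ open_ball]) auto
    ultimately show ?thesis using n by (simp add: b_def higher_deriv_const)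
  qed
  have c0: "c 0 = 1" by (simp add: c_def p_def)
  have k0: "0 < k" using k by simp
  define \<gamma> \<delta> where "\<gamma> = c k / 2" and "\<delta> = c (2 * k) / 2"
  have p0: "p 0 = 1" by (simp add: p_def)
  note car = Caratheodory_coeff_bounds[OF p_hol p_pos k0 p0 \<gamma>_def[unfolded c_def] \<delta>_def[unfolded c_def]]
  note bc = logderiv_coeffs_gap[OF rec b0 c0 k0 gap]
  have A: "b k = 2 * \<gamma> / of_nat k" and B: "b (2 * k) = (2 * \<delta> + (2 * \<gamma>)\<^sup>2 / of_nat k) / of_nat (2 * k)"
    using bc by (simp_all add: \<gamma>_def \<delta>_def)
  have T: "T = cmod (1 - (b (2 * k))\<^sup>2 - 2 * (b k)\<^sup>2 + 2 * (b k)\<^sup>2 * b (2 * k))"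
    by (simp add: T_def a)
  show "k \<le> 3 \<Longrightarrow> T \<le> 1 + 8 / real k ^ 2 + (real k + 2) * (6 - real k) / real k ^ 4"
    and "3 \<le> k \<Longrightarrow> T \<le> 1 + 8 / real k ^ 2 + (2 + real k) / real k ^ 3"
    unfolding T using Toeplitz_determinant_bound[OF car k A B] by blast+
qed

section \<open>Extremal mappings\<close>

text \<open>The principal branch of (1 - i s^k)^{-2/k}; times s it is a rotation of the k-fold
  symmetric Koebe function.\<close>

definition koebe_root :: "nat \<Rightarrow> complex \<Rightarrow> complex"
  where "koebe_root k s = exp (- (2 / of_nat k) * Ln (1 - \<i> * s ^ k))"

lemma koebe_root_0 [simp]: "0 < k \<Longrightarrow> koebe_root k 0 = 1"
  by (simp add: koebe_root_def power_0_left)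

lemma koebe_root_nonzero [simp]: "koebe_root k s \<noteq> 0"
  by (simp add: koebe_root_def)

text \<open>The first claim keeps the argument of \<open>Ln\<close> off its branch cut. The last
  quotient is the Cayley transform of w = i s^k, with real part (1 - |w|^2) / |1 - w|^2; it is the
  value of 1 + s h'/h for h = \<open>koebe_root k\<close>.\<close>

lemma koebe_denominator:
  assumes "0 < k" "norm s < 1"
  shows "0 < Re (1 - \<i> * s ^ k)" and "1 - \<i> * s ^ k \<noteq> 0"
    and "0 < Re ((1 + \<i> * s ^ k) / (1 - \<i> * s ^ k))"
proof -
  define w where "w = \<i> * s ^ k"
  have w: "norm w < 1" using assms by (simp add: w_def norm_mult norm_power power_less_one_iff)
  then have "Re w < 1" using complex_Re_le_cmod[of w] by linarith
  then show pos: "0 < Re (1 - \<i> * s ^ k)" by (simp add: w_def)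
  then show "1 - \<i> * s ^ k \<noteq> 0" by (metis less_irrefl zero_complex.sel(1))
  then have nz: "1 - w \<noteq> 0" by (simp add: w_def)
  have "Re ((1 + w) / (1 - w)) = Re ((1 + w) * cnj (1 - w)) / (norm (1 - w))\<^sup>2"
    by (simp only: complex_div_cnj[of "1 + w" "1 - w"] Re_divide_of_real flip: of_real_power)
  also have "Re ((1 + w) * cnj (1 - w)) = 1 - (norm w)\<^sup>2"
    unfolding cmod_power2 by (simp add: power2_eq_square algebra_simps)
  finally have "Re ((1 + w) / (1 - w)) = (1 - (norm w)\<^sup>2) / (norm (1 - w))\<^sup>2" .
  moreover have "(norm w)\<^sup>2 < 1" using w by (simp add: power_less_one_iff abs_square_less_1)
  ultimately show "0 < Re ((1 + \<i> * s ^ k) / (1 - \<i> * s ^ k))"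
    using nz by (simp add: w_def divide_pos_pos)
qed

lemma koebe_root_has_field_derivative:
  assumes "0 < k" "norm s < 1"
  shows "(koebe_root k has_field_derivative
    koebe_root k s * (2 * \<i> * s ^ (k - 1) / (1 - \<i> * s ^ k))) (at s)"
proof -
  have "1 - \<i> * s ^ k \<notin> \<real>\<^sub>\<le>\<^sub>0"
    using koebe_denominator(1)[OF assms] by (auto simp: complex_nonpos_Reals_iff)
  then have "((\<lambda>s. Ln (1 - \<i> * s ^ k)) has_field_derivative
      - (\<i> * (of_nat k * s ^ (k - 1))) / (1 - \<i> * s ^ k)) (at s)"
    by (auto intro!: derivative_eq_intros simp: divide_inverse mult_ac)
  from DERIV_fun_exp[OF DERIV_cmult[OF this, of "- (2 / of_nat k)"]]
  have "(koebe_root k has_field_derivative koebe_root k s *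
      (- (2 / of_nat k) * (- (\<i> * (of_nat k * s ^ (k - 1))) / (1 - \<i> * s ^ k)))) (at s)"
    by (simp only: koebe_root_def[abs_def])
  moreover have "- (2 / of_nat k) * (- (\<i> * (of_nat k * s ^ (k - 1))) / (1 - \<i> * s ^ k))
      = 2 * \<i> * s ^ (k - 1) / (1 - \<i> * s ^ k)"
    using assms by simp
  ultimately show ?thesis by (simp only:)
qed

lemma koebe_root_holomorphic: "0 < k \<Longrightarrow> koebe_root k holomorphic_on ball 0 1"
  unfolding holomorphic_on_open[OF open_ball]
  by (intro ballI exI, rule koebe_root_has_field_derivative) auto

text \<open>The coefficients are read off the differential equation (1 - i s^k) s h' = 2 i s^k h,
  which links \<open>b n\<close> only to \<open>b (n - k)\<close>.\<close>

lemma koebe_root_coeffs: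
  assumes k: "0 < k"
  defines "b \<equiv> (\<lambda>n. (deriv ^^ n) (koebe_root k) 0 / fact n)"
  shows "\<And>n. 0 < n \<Longrightarrow> n < k \<Longrightarrow> b n = 0"
    and "b k = 2 * \<i> / of_nat k" and "b (2 * k) = - (of_nat k + 2) / (of_nat k)\<^sup>2"
proof -
  let ?H = "fps_expansion (koebe_root k) 0"
  have H: "koebe_root k has_fps_expansion ?H"
    using has_fps_expansion_fps_expansion[OF open_ball _ koebe_root_holomorphic[OF k]] by simp
  have lhs: "(\<lambda>s. s * deriv (koebe_root k) s - \<i> * (s ^ k * (s * deriv (koebe_root k) s))) has_fps_expansion
      fps_X * fps_deriv ?H - fps_const \<i> * (fps_X ^ k * (fps_X * fps_deriv ?H))"
    by (intro fps_expansion_intros H)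
  have rhs: "(\<lambda>s. 2 * \<i> * (s ^ k * koebe_root k s)) has_fps_expansion fps_const (2 * \<i>) * (fps_X ^ k * ?H)"
    by (intro fps_expansion_intros H)
  have eq: "s * deriv (koebe_root k) s - \<i> * (s ^ k * (s * deriv (koebe_root k) s)) = 2 * \<i> * (s ^ k * koebe_root k s)"
    if "s \<in> ball 0 1" for s
  proof -
    have s: "norm s < 1" using that by simp
    have "s * deriv (koebe_root k) s - \<i> * (s ^ k * (s * deriv (koebe_root k) s))
        = s * deriv (koebe_root k) s * (1 - \<i> * s ^ k)"
      by (simp add: algebra_simps)
    also have "\<dots> = 2 * \<i> * (s * s ^ (k - 1)) * koebe_root k s"
      using DERIV_imp_deriv[OF koebe_root_has_field_derivative[OF k s]] koebe_denominator(2)[OF k s] by simp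
    also have "s * s ^ (k - 1) = s ^ k" using k by (metis power_eq_if not_gr_zero)
    finally show ?thesis by (simp only: mult.assoc)
  qed
  have "\<forall>\<^sub>F s in nhds 0. s \<in> ball (0 :: complex) 1" by (intro eventually_nhds_in_open) auto
  then have "\<forall>\<^sub>F s in nhds 0. s * deriv (koebe_root k) s - \<i> * (s ^ k * (s * deriv (koebe_root k) s))
      = 2 * \<i> * (s ^ k * koebe_root k s)"
    by eventually_elim (rule eq)
  from has_fps_expansion_cong[OF this refl] lhs
  have "(\<lambda>s. 2 * \<i> * (s ^ k * koebe_root k s)) has_fps_expansion
      fps_X * fps_deriv ?H - fps_const \<i> * (fps_X ^ k * (fps_X * fps_deriv ?H))" by blast
  from fps_expansion_unique_complex[OF this rhs]
  have "fps_nth (fps_X * fps_deriv ?H - fps_const \<i> * (fps_X ^ k * (fps_X * fps_deriv ?H))) n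
      = fps_nth (fps_const (2 * \<i>) * (fps_X ^ k * ?H)) n" for n by simp
  moreover have nth: "fps_nth ?H n = b n" for n by (simp add: fps_expansion_def b_def)
  moreover have "fps_nth (fps_X * fps_deriv ?H) n = of_nat n * b n" for n
    by (cases n) (simp_all add: nth)
  ultimately have rec: "of_nat n * b n - \<i> * (if n < k then 0 else of_nat (n - k) * b (n - k))
      = 2 * \<i> * (if n < k then 0 else b (n - k))" for n
    by (simp only: fps_sub_nth fps_mult_left_const_nth fps_X_power_mult_nth)
  have b0: "b 0 = 1" using k by (simp add: b_def)
  show "b n = 0" if "0 < n" "n < k" for n using rec[of n] that by simp
  have "of_nat k * b k = 2 * \<i>" using rec[of k] b0 by simp
  moreover have k': "(of_nat k :: complex) \<noteq> 0" unfolding of_nat_eq_0_iff using k by simp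
  ultimately show bk: "b k = 2 * \<i> / of_nat k" by (metis nonzero_mult_div_cancel_left)
  have "of_nat (2 * k) * b (2 * k) = \<i> * (of_nat k * b k) + 2 * \<i> * b k"
  proof -
    have "\<not> 2 * k < k" "2 * k - k = k" by simp_all
    with rec[of "2 * k"] show ?thesis by (simp only: if_False) (simp only: diff_eq_eq add.commute mult.assoc)
  qed
  also have "\<dots> = of_nat (2 * k) * (- (of_nat k + 2) / (of_nat k)\<^sup>2)"
    using k' by (simp add: bk field_simps power2_eq_square)
  finally show "b (2 * k) = - (of_nat k + 2) / (of_nat k)\<^sup>2"
    by (rule mult_left_cancel[THEN iffD1, rotated]) (use k in simp)
qed

section \<open>Mappings that depend on a functional: starlikeness, order of the zero,
  equality\<close>

lemma has_derivative_compose_functional: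
  fixes l :: "'a::complex_banach \<Rightarrow> complex"
  assumes "bounded_clinear l" "(h has_field_derivative h') (at (l z))"
  shows "((\<lambda>z. h (l z)) has_derivative (\<lambda>v. h' * l v)) (at z)"
proof -
  have "(l has_derivative l) (at z)"
    by (rule bounded_linear_imp_has_derivative[OF bounded_clinear_imp_bounded_linear[OF assms(1)]])
  from diff_chain_at[OF this has_field_derivative_imp_has_derivative[OF assms(2)]]
  show ?thesis by (simp add: o_def)
qed

lemma holomorphic_map_on_compose_functional:
  fixes l :: "'a::complex_banach \<Rightarrow> complex"
  assumes l: "bounded_clinear l" and h: "h holomorphic_on T" "open T" and S: "\<And>z. z \<in> S \<Longrightarrow> l z \<in> T"
  shows "holomorphic_map_on (\<lambda>z. h (l z)) S"
proof (rule holomorphic_map_onI)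
  show "((\<lambda>z. h (l z)) has_derivative (\<lambda>v. deriv h (l z) * l v)) (at z)" if "z \<in> S" for z
    using has_derivative_compose_functional[OF l holomorphic_derivI[OF h S[OF that]]] .
  show "bounded_clinear (\<lambda>v. deriv h (l z) * l v)" for z
    using l bounded_linear_const_mult[OF bounded_clinear_imp_bounded_linear[OF l]]
    by (simp add: bounded_clinear_def scaleC_complex_def)
qed

text \<open>The order of a zero involves arbitrary tuples \<open>v\<close>, not just constant ones.
  \<open>P\<close> (in the construction, the product of the \<open>l (v i)\<close>) and
  \<open>W\<close> do not depend on \<open>y\<close>; at y = 0 only the \<open>W\<close> term
  survives, and it carries a derivative of \<open>H\<close> of order j - 1.\<close>

lemma nth_frechet_derivative_ridge_mult_id:
  fixes l :: "'a::complex_banach \<Rightarrow> complex"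
  assumes l: "bounded_clinear l" and H: "H holomorphic_on T" "open T"
    and S: "open S" "\<And>y. y \<in> S \<Longrightarrow> l y \<in> T"
  shows "\<exists>P W. (j = 0 \<longrightarrow> W = 0) \<and> (\<forall>y\<in>S. nth_frechet_derivative j (\<lambda>z. H (l z) *\<^sub>C z) y v =
    ((deriv ^^ j) H (l y) * P) *\<^sub>C y + (deriv ^^ (j - 1)) H (l y) *\<^sub>C W)"
proof (induction j)
  case 0
  show ?case by (rule exI[of _ 1], rule exI[of _ 0]) simp
next
  case (Suc j)
  then obtain P W where W: "j = 0 \<longrightarrow> W = 0" and
    IH: "\<And>y. y \<in> S \<Longrightarrow> nth_frechet_derivative j (\<lambda>z. H (l z) *\<^sub>C z) y v =
      ((deriv ^^ j) H (l y) * P) *\<^sub>C y + (deriv ^^ (j - 1)) H (l y) *\<^sub>C W"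
    by blast
  define w where "w = v j"
  have "nth_frechet_derivative (Suc j) (\<lambda>z. H (l z) *\<^sub>C z) y v =
    ((deriv ^^ Suc j) H (l y) * (P * l w)) *\<^sub>C y + (deriv ^^ j) H (l y) *\<^sub>C (P *\<^sub>C w + l w *\<^sub>C W)"
    if y: "y \<in> S" for y
  proof -
    have d: "((\<lambda>z. (deriv ^^ n) H (l z)) has_derivative (\<lambda>v. (deriv ^^ Suc n) H (l y) * l v)) (at y)" for n
      using has_derivative_compose_functional[OF l has_field_derivative_higher_deriv[OF H S(2)[OF y]]] .
    have "((\<lambda>y. ((deriv ^^ j) H (l y) * P) *\<^sub>C y + (deriv ^^ (j - 1)) H (l y) *\<^sub>C W) has_derivative
        (\<lambda>v. (((deriv ^^ j) H (l y) * P) *\<^sub>C v + ((deriv ^^ Suc j) H (l y) * l v * P) *\<^sub>C y)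
          + ((deriv ^^ Suc (j - 1)) H (l y) * l v) *\<^sub>C W)) (at y)"
      by (intro has_derivative_add has_derivative_mult_id has_derivative_mult_left d
          bounded_linear.has_derivative[OF bounded_bilinear.bounded_linear_left[OF bounded_bilinear_scaleC]])
    then have "((\<lambda>y. nth_frechet_derivative j (\<lambda>z. H (l z) *\<^sub>C z) y v) has_derivative
        (\<lambda>v. (((deriv ^^ j) H (l y) * P) *\<^sub>C v + ((deriv ^^ Suc j) H (l y) * l v * P) *\<^sub>C y)
          + ((deriv ^^ Suc (j - 1)) H (l y) * l v) *\<^sub>C W)) (at y)"
      by (rule has_derivative_transform_within_open[OF _ S(1) y]) (simp only: IH)
    from frechet_derivative_at[OF this]
    have "nth_frechet_derivative (Suc j) (\<lambda>z. H (l z) *\<^sub>C z) y v =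
        (((deriv ^^ j) H (l y) * P) *\<^sub>C w + ((deriv ^^ Suc j) H (l y) * l w * P) *\<^sub>C y)
          + ((deriv ^^ Suc (j - 1)) H (l y) * l w) *\<^sub>C W"
      by (simp add: fun_eq_iff w_def)
    \<comment> \<open>For j = 0 the truncated index gives order 1 instead of 0; the invariant
      \<open>W = 0\<close> covers this case.\<close>
    also have "((deriv ^^ Suc (j - 1)) H (l y) * l w) *\<^sub>C W = ((deriv ^^ j) H (l y) * l w) *\<^sub>C W"
      using W by (cases j) auto
    finally show ?thesis
      by (simp add: scaleC_add_right scaleC_scaleC mult_ac)
  qed
  then show ?case by auto
qed

text \<open>DF(z) is a multiple of the identity plus a rank-one operator with range spanned by z,
  hence explicitly invertible. The inverse takes F(z) to z / q(l z), so every support functional of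
  z yields \<open>norm z\<close> / q(l z), and only Re q > 0 has to be known.\<close>

lemma starlike_mapping_koebe_root:
  fixes l :: "'a::complex_banach \<Rightarrow> complex"
  assumes k: "0 < k" and l: "bounded_clinear l" "\<And>x. norm (l x) \<le> norm x"
  shows "starlike_mapping (\<lambda>z. koebe_root k (l z) *\<^sub>C z)"
proof -
  let ?F = "\<lambda>z. koebe_root k (l z) *\<^sub>C z"
  have ls: "norm (l z) < 1" if "z \<in> ball 0 1" for z
    using l(2)[of z] that by simp
  note lin = linear_add[OF bounded_linear.linear[OF bounded_clinear_imp_bounded_linear[OF l(1)]]]
    linear_diff[OF bounded_linear.linear[OF bounded_clinear_imp_bounded_linear[OF l(1)]]]
    bounded_clinear_scaleC[OF l(1), unfolded scaleC_complex_def]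
  have l0: "l 0 = 0" using lin(3)[of 0 0] by simp
  \<comment> \<open>\<open>\<kappa>\<close> is the logarithmic derivative of
    \<open>koebe_root k\<close>, and \<open>q\<close> is 1 + s h'/h for h =
    \<open>koebe_root k\<close>.\<close>
  define \<kappa> where "\<kappa> s = 2 * \<i> * s ^ (k - 1) / (1 - \<i> * s ^ k)" for s :: complex
  define q where "q s = 1 + \<kappa> s * s" for s
  define D where "D z v = koebe_root k (l z) *\<^sub>C v + (koebe_root k (l z) * \<kappa> (l z) * l v) *\<^sub>C z" for z v
  \<comment> \<open>The Sherman-Morrison formula for the inverse of \<open>D z\<close>; its
    denominator is \<open>q (l z)\<close>.\<close>
  define E where "E z w = (1 / koebe_root k (l z)) *\<^sub>C w
    - (\<kappa> (l z) / (q (l z) * koebe_root k (l z)) * l w) *\<^sub>C z" for z w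
  have q: "q s = (1 + \<i> * s ^ k) / (1 - \<i> * s ^ k)" if "norm s < 1" for s
  proof -
    have "\<kappa> s * s = 2 * \<i> * (s * s ^ (k - 1)) / (1 - \<i> * s ^ k)" by (simp add: \<kappa>_def)
    also have "s * s ^ (k - 1) = s ^ k" using k by (metis power_eq_if not_gr_zero)
    finally have "q s = 1 + 2 * \<i> * s ^ k / (1 - \<i> * s ^ k)" by (simp add: q_def)
    then show ?thesis
      using koebe_denominator(2)[OF k that] by (simp add: field_simps)
  qed
  have q_pos: "0 < Re (q (l z))" if "z \<in> ball 0 1" for z
    using q[OF ls[OF that]] koebe_denominator(3)[OF k ls[OF that]] by simp
  have q_nz: "q (l z) \<noteq> 0" if "z \<in> ball 0 1" for z
    using q_pos[OF that] by auto
  have der: "(?F has_derivative D z) (at z)" if "z \<in> ball 0 1" for z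
    unfolding D_def[abs_def] \<kappa>_def
    by (rule has_derivative_mult_id[OF has_derivative_compose_functional[OF l(1)
          koebe_root_has_field_derivative[OF k ls[OF that]]]])
  then have fder: "frechet_derivative ?F (at z) = D z" if "z \<in> ball 0 1" for z
    using frechet_derivative_at that by metis
  have D_clin: "bounded_clinear (D z)" if "z \<in> ball 0 1" for z
    using has_derivative_bounded_linear[OF der[OF that]]
    by (simp add: bounded_clinear_def D_def lin scaleC_add_right scaleC_scaleC mult_ac)
  have E_clin: "bounded_clinear (E z)" for z
  proof -
    have "bounded_linear (E z)"
      unfolding E_def[abs_def]
      by (intro bounded_linear_sub bounded_bilinear.bounded_linear_right[OF bounded_bilinear_scaleC]
          bounded_linear_compose[OF bounded_bilinear.bounded_linear_left[OF bounded_bilinear_scaleC]]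
          bounded_linear_const_mult bounded_clinear_imp_bounded_linear[OF l(1)])
    then show ?thesis
      by (simp add: bounded_clinear_def E_def lin scaleC_diff_right scaleC_scaleC mult_ac)
  qed
  have DE: "D z (E z w) = w" and ED: "E z (D z w) = w" if z: "z \<in> ball 0 1" for z w
  proof -
    let ?h = "koebe_root k (l z)" and ?\<kappa> = "\<kappa> (l z)" and ?q = "q (l z)"
    have "?q \<noteq> 0" by (rule q_nz[OF z])
    then have *: "1 - ?\<kappa> * l z / ?q = 1 / ?q" by (simp add: q_def field_simps)
    have "l (E z w) = l w / ?h * (1 - ?\<kappa> * l z / ?q)"
      by (simp add: E_def lin algebra_simps)
    then have lE: "l (E z w) = l w / (?h * ?q)" unfolding * by simp
    have "D z (E z w) = w - (?\<kappa> / ?q * l w) *\<^sub>C z + (?h * ?\<kappa> * l (E z w)) *\<^sub>C z"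
      by (simp add: D_def E_def scaleC_diff_right scaleC_scaleC)
    also have "?h * ?\<kappa> * l (E z w) = ?\<kappa> / ?q * l w" by (simp add: lE)
    finally show "D z (E z w) = w" by simp
    have lD: "l (D z w) = ?h * ?q * l w" by (simp add: D_def lin q_def algebra_simps)
    have "E z (D z w) = w + (?\<kappa> * l w) *\<^sub>C z - (?\<kappa> / (?q * ?h) * l (D z w)) *\<^sub>C z"
      by (simp add: E_def D_def scaleC_add_right scaleC_scaleC)
    also have "?\<kappa> / (?q * ?h) * l (D z w) = ?\<kappa> * l w" using q_nz[OF z] by (simp add: lD)
    finally show "E z (D z w) = w" by simp
  qed
  have inv: "inv (D z) = E z" and bij: "bij (D z)" if "z \<in> ball 0 1" for z
    using DE[OF that] ED[OF that] by (auto intro!: inv_equality o_bij[of "E z"])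
  have EF: "E z (?F z) = (1 / q (l z)) *\<^sub>C z" if z: "z \<in> ball 0 1" for z
  proof -
    have "E z (?F z) = (1 - \<kappa> (l z) * l z / q (l z)) *\<^sub>C z"
      by (simp add: E_def lin scaleC_scaleC scaleC_diff_left)
    also have "1 - \<kappa> (l z) * l z / q (l z) = 1 / q (l z)"
      using q_nz[OF z] by (simp add: q_def field_simps)
    finally show ?thesis .
  qed
  show ?thesis
    unfolding starlike_mapping_def normalized_map_def locally_biholomorphic_on_def has_bounded_inverse_def
  proof (intro conjI ballI)
    show "frechet_derivative ?F (at 0) = (\<lambda>v. v)"
      using fder[of 0] k by (simp add: D_def[abs_def] l0)
    show "holomorphic_map_on ?F (ball 0 1)"
      by (rule holomorphic_map_onI[OF der D_clin])
    fix z :: 'a assume z: "z \<in> ball 0 1"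
    show "bij (frechet_derivative ?F (at z))" unfolding fder[OF z] by (rule bij[OF z])
    show "bounded_clinear (inv (frechet_derivative ?F (at z)))" unfolding fder[OF z] inv[OF z] by (rule E_clin)
  next
    fix z :: 'a and lz assume z: "z \<in> ball 0 1 - {0}" and lz: "lz \<in> support_functionals z"
    then have zb: "z \<in> ball 0 1" by simp
    have "lz (inv (frechet_derivative ?F (at z)) (?F z)) = of_real (norm z) / q (l z)"
      unfolding fder[OF zb] inv[OF zb] EF[OF zb]
        bounded_clinear_scaleC[OF support_functionalsD(1)[OF lz], unfolded scaleC_complex_def]
        support_functionalsD(2)[OF lz] by simp
    moreover have "Re (of_real (norm z) / q (l z)) = norm z * Re (q (l z)) / (norm (q (l z)))\<^sup>2"
      by (simp add: Re_divide cmod_power2)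
    ultimately show "0 < Re (lz (inv (frechet_derivative ?F (at z)) (?F z)))"
      using z q_pos[of z] q_nz[of z] by (simp add: divide_pos_pos)
  qed simp
qed

text \<open>Up to order k the ridge formula at 0 meets only vanishing derivatives of
  \<open>koebe_root k - 1\<close>. At order k + 1 the constant tuple \<open>u\<close> detects the
  coefficient 2i/k, because \<open>l u = 1\<close>.\<close>

lemma zero_of_order_koebe_root:
  fixes l :: "'a::complex_banach \<Rightarrow> complex"
  assumes k: "0 < k" and u: "norm u = 1" and l: "l \<in> support_functionals u"
  shows "zero_of_order (k + 1) (\<lambda>z. koebe_root k (l z) *\<^sub>C z - z)"
proof -
  let ?H = "\<lambda>s. koebe_root k s - 1"
  note lD = support_functionalsD[OF l]
  have eq: "(\<lambda>z. koebe_root k (l z) *\<^sub>C z - z) = (\<lambda>z. ?H (l z) *\<^sub>C z)"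
    by (simp add: scaleC_diff_left)
  have lu: "l (s *\<^sub>C u) = s" for s
    using bounded_clinear_scaleC[OF lD(1), of s u] lD(2) u by (simp add: scaleC_complex_def)
  have l0: "l 0 = 0" using lu[of 0] by simp
  have hol: "?H holomorphic_on ball 0 1"
    by (intro holomorphic_intros koebe_root_holomorphic k)
  have ls: "l z \<in> ball 0 1" if "z \<in> ball 0 1" for z
    using lD(3)[of z] that by simp
  have H_deriv: "(deriv ^^ n) ?H 0 = (deriv ^^ n) (koebe_root k) 0" if "0 < n" for n
  proof -
    have "(deriv ^^ n) ?H 0 = (deriv ^^ n) (koebe_root k) 0 - (deriv ^^ n) (\<lambda>_. 1) 0"
      by (rule higher_deriv_diff[OF koebe_root_holomorphic[OF k] _ open_ball]) auto
    then show ?thesis using that by (simp add: higher_deriv_const)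
  qed
  have H0: "(deriv ^^ n) ?H 0 = 0" if "n < k" for n
    using koebe_root_coeffs(1)[OF k, of n] that H_deriv[of n] k by (cases "n = 0") auto
  show ?thesis
    unfolding zero_of_order_def eq
  proof (intro conjI allI impI)
    fix j :: nat and v :: "nat \<Rightarrow> 'a" assume j: "1 \<le> j \<and> j < k + 1"
    obtain P W where "\<forall>y\<in>ball 0 1. nth_frechet_derivative j (\<lambda>z. ?H (l z) *\<^sub>C z) y v =
        ((deriv ^^ j) ?H (l y) * P) *\<^sub>C y + (deriv ^^ (j - 1)) ?H (l y) *\<^sub>C W"
      using nth_frechet_derivative_ridge_mult_id[OF lD(1) hol open_ball open_ball ls, where j = j and v = v] by blast
    moreover have "j - 1 < k" using j by auto
    ultimately show "nth_frechet_derivative j (\<lambda>z. ?H (l z) *\<^sub>C z) 0 v = 0"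
      using H0[of "j - 1"] by (simp add: l0)
  next
    have f1: "holomorphic_map_on (\<lambda>z. ?H (l z)) (ball 0 1)"
      by (rule holomorphic_map_on_compose_functional[OF lD(1) hol open_ball ls])
    have "nth_frechet_derivative k (\<lambda>z. ?H (l z)) 0 (\<lambda>_. u) = (deriv ^^ k) ?H 0"
      using higher_deriv_along_line[OF f1 open_ball, of 0 0 u k] by (simp add: lu)
    also have "\<dots> \<noteq> 0"
      using koebe_root_coeffs(2)[OF k] H_deriv[OF k] k by auto
    finally have "nth_frechet_derivative k (\<lambda>z. ?H (l z)) 0 (\<lambda>_. u) \<noteq> 0" .
    moreover have "nth_frechet_derivative (k + 1) (\<lambda>z. ?H (l z) *\<^sub>C z) 0 (\<lambda>_. u) =
        (of_nat (k + 1) * nth_frechet_derivative k (\<lambda>z. ?H (l z)) 0 (\<lambda>_. u)) *\<^sub>C u"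
      using nth_frechet_derivative_mult_id[OF f1 open_ball, of 0 "k + 1" u]
      by (simp del: nth_frechet_derivative.simps)
    moreover have "u \<noteq> 0" using u by auto
    moreover have "(of_nat (k + 1) :: complex) \<noteq> 0" unfolding of_nat_eq_0_iff by simp
    ultimately show "\<exists>v. nth_frechet_derivative (k + 1) (\<lambda>z. ?H (l z) *\<^sub>C z) 0 v \<noteq> 0"
      by (metis scaleC_eq_0_iff mult_eq_0_iff)
  qed simp
qed

lemma Toeplitz_determinant_sharp:
  assumes nontrivial: "(UNIV :: 'a::complex_banach set) \<noteq> {0}" and k: "k \<in> {1, 2, 3 :: nat}"
  shows "\<exists>f :: 'a \<Rightarrow> complex.
        holomorphic_map_on f (ball 0 1) \<and>
        starlike_mapping (\<lambda>z. f z *\<^sub>C z) \<and>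
        zero_of_order (k + 1) (\<lambda>z. f z *\<^sub>C z - z) \<and>
        (\<exists>z \<in> ball 0 1 - {0}. \<exists>l \<in> support_functionals z.
           let a = taylor_coeff (\<lambda>z. f z *\<^sub>C z) z l;
               T = cmod (1 - (a (2*k+1))^2 - 2 * (a (k+1))^2 + 2 * (a (k+1))^2 * a (2*k+1))
           in T = 1 + 8 / real k ^ 2 + (real k + 2) * (6 - real k) / real k ^ 4)"
proof -
  have k0: "0 < k" using k by auto
  obtain x :: 'a where x: "x \<noteq> 0" using nontrivial by auto
  define u where "u = complex_of_real (1 / norm x) *\<^sub>C x"
  have u: "norm u = 1" using x by (simp add: u_def norm_scaleC norm_divide)
  then have "u \<noteq> 0" by auto
  then obtain l where l: "l \<in> support_functionals u" using ex_support_functional by blast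
  note lD = support_functionalsD[OF l]
  have lu: "l (s *\<^sub>C u) = s" for s
    using bounded_clinear_scaleC[OF lD(1), of s u] lD(2) u by (simp add: scaleC_complex_def)
  define f where "f z = koebe_root k (l z)" for z
  have f_hol: "holomorphic_map_on f (ball 0 1)"
    unfolding f_def
  proof (rule holomorphic_map_on_compose_functional[OF lD(1) koebe_root_holomorphic[OF k0] open_ball])
    show "l z \<in> ball 0 1" if "z \<in> ball 0 1" for z using lD(3)[of z] that by simp
  qed
  \<comment> \<open>Any positive multiple of \<open>u\<close> inside the ball would do:
    \<open>l\<close> supports it too, and the coefficients depend only on the direction.\<close>
  define z where "z = complex_of_real (1 / 2) *\<^sub>C u"
  have nz: "norm z = 1 / 2" by (simp add: z_def norm_scaleC u norm_divide)
  have z: "z \<in> ball 0 1 - {0}" using \<open>u \<noteq> 0\<close> nz by (auto simp: z_def)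
  have uz: "u = complex_of_real (1 / norm z) *\<^sub>C z" by (simp add: nz) (simp add: z_def scaleC_scaleC)
  have lz: "l \<in> support_functionals z"
  proof (rule support_functionalsI[OF _ lD(1) _ lD(3)])
    show "l z = of_real (norm z)" unfolding nz by (simp add: z_def lu)
  qed (use z in simp)
  define a where "a = taylor_coeff (\<lambda>z. f z *\<^sub>C z) z l"
  have "a (Suc m) = (deriv ^^ m) (koebe_root k) 0 / fact m" for m
    using taylor_coeff_mult_id[OF f_hol z lz uz, of m] by (simp add: a_def f_def lu)
  then have A: "a (k + 1) = 2 * \<i> / of_nat k" and B: "a (2 * k + 1) = - (of_nat k + 2) / (of_nat k)\<^sup>2"
    using koebe_root_coeffs(2,3)[OF k0] by simp_all
  \<comment> \<open>Here A^2 = -4/k^2 and B - 2A^2 = (6 - k)/k^2, so the terms of 1 - 2A^2 - B (B -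
    2A^2) are positive reals and the modulus loses nothing.\<close>
  have T: "1 - (a (2*k+1))^2 - 2 * (a (k+1))^2 + 2 * (a (k+1))^2 * a (2*k+1)
      = complex_of_real (1 + 8 / real k ^ 2 + (real k + 2) * (6 - real k) / real k ^ 4)"
    unfolding A B using k by (auto simp: power2_eq_square field_simps)
  have "cmod (1 - (a (2*k+1))^2 - 2 * (a (k+1))^2 + 2 * (a (k+1))^2 * a (2*k+1))
      = 1 + 8 / real k ^ 2 + (real k + 2) * (6 - real k) / real k ^ 4"
    unfolding T norm_of_real using k by auto
  then show ?thesis
    using f_hol starlike_mapping_koebe_root[OF k0 lD(1,3)] zero_of_order_koebe_root[OF k0 u l] z lz
    unfolding Let_def a_def f_def by blast
qed

theorem theorem7:
  assumes nontrivial: "(UNIV :: 'a::complex_banach set) \<noteq> {0}"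
  shows
    "(\<forall>(k::nat) (f :: 'a \<Rightarrow> complex).
        1 \<le> k \<longrightarrow>
        holomorphic_map_on f (ball 0 1) \<longrightarrow>
        starlike_mapping (\<lambda>z. f z *\<^sub>C z) \<longrightarrow>
        zero_of_order (k + 1) (\<lambda>z. f z *\<^sub>C z - z) \<longrightarrow>
        (\<forall>z \<in> ball 0 1 - {0}. \<forall>l \<in> support_functionals z.
           let a = taylor_coeff (\<lambda>z. f z *\<^sub>C z) z l;
               T = cmod (1 - (a (2*k+1))^2 - 2 * (a (k+1))^2 + 2 * (a (k+1))^2 * a (2*k+1))
           in (1 \<le> k \<and> k \<le> 3 \<longrightarrow>
                 T \<le> 1 + 8 / real k ^ 2 + (real k + 2) * (6 - real k) / real k ^ 4) \<and>
              (3 \<le> k \<longrightarrow>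
                 T \<le> 1 + 8 / real k ^ 2 + (2 + real k) / real k ^ 3)))
     \<and>
     (\<forall>k \<in> {1, 2, 3::nat}. \<exists>f :: 'a \<Rightarrow> complex.
        holomorphic_map_on f (ball 0 1) \<and>
        starlike_mapping (\<lambda>z. f z *\<^sub>C z) \<and>
        zero_of_order (k + 1) (\<lambda>z. f z *\<^sub>C z - z) \<and>
        (\<exists>z \<in> ball 0 1 - {0}. \<exists>l \<in> support_functionals z.
           let a = taylor_coeff (\<lambda>z. f z *\<^sub>C z) z l;
               T = cmod (1 - (a (2*k+1))^2 - 2 * (a (k+1))^2 + 2 * (a (k+1))^2 * a (2*k+1))
           in T = 1 + 8 / real k ^ 2 + (real k + 2) * (6 - real k) / real k ^ 4))"
  unfolding Let_def
  by (intro conjI allI impI ballI Toeplitz_determinant_starlike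
      Toeplitz_determinant_sharp[OF nontrivial, unfolded Let_def]) (assumption | elim conjE, assumption)+

end
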